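(* Let $\gamma\in(0,1/3)$. There exists a constant $C>0$, depending only on $n$ and $\gamma$, such that the following holds. Let $u:\mathbb{R}^n\to\mathbb{R}$ be a viscosity solution of $$\Delta u=u_+^\gamma-u_-^\gamma\quad\text{in } B_1.$$ If $x_0\in B_{1/2}$ is a branching point for $u$, i.e. $u(x_0)=|Du(x_0)|=|D^2u(x_0)|=0$, then $$|u(x)|\le C\|u\|_{L^\infty(\mathbb{R}^n)}|x-x_0|^{\frac{2}{1-\gamma}},\quad\forall x\in B_{1/2}(x_0).$$ As a consequence, $u\in C^{\frac{2}{1-\gamma}}$ at branching points.
   Context: $B_r(x_0)$ is the open ball in $\mathbb{R}^n$ of radius $r$ centered at $x_0$, and $B_r:=B_r(0)$. $u_+:=\max(u,0)$, $u_-:=(-u)_+$. Viscosity solutions of the local equation are understood in the usual sense. The phrase "$u\in C^{\frac{2}{1-\gamma}}$ at branching points" means pointwise regularity in the sense of the growth estimate $|u(x)|\le C|x-x_0|^{\frac{2}{1-\gamma}}$ near each branching point $x_0$. *)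

theory Defs
  imports "HOL-Analysis.Analysis" "HOL-Probability.Essential_Supremum"
begin

definition gradient :: "(real^'n \<Rightarrow> real) \<Rightarrow> real^'n \<Rightarrow> real^'n" where
  "gradient f x = (\<chi> i. frechet_derivative f (at x) (axis i 1))"

definition hessian :: "(real^'n \<Rightarrow> real) \<Rightarrow> real^'n \<Rightarrow> real^'n^'n" where
  "hessian f x = jacobian (gradient f) (at x)"

definition laplacian :: "(real^'n \<Rightarrow> real) \<Rightarrow> real^'n \<Rightarrow> real" where
  "laplacian f x = trace (hessian f x)"

text \<open>\<^const>\<open>gradient\<close> and \<^const>\<open>hessian\<close> are total functions, with unspecified values where
  the derivatives do not exist; the following predicate states that they are the true derivatives
  at \<open>x\<close>.\<close>

definition twice_differentiable_at :: "(real^'n \<Rightarrow> real) \<Rightarrow> real^'n \<Rightarrow> bool" where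
  "twice_differentiable_at f x \<longleftrightarrow>
     (\<forall>\<^sub>F y in nhds x. f differentiable (at y)) \<and> gradient f differentiable (at x)"

text \<open>Used on open sets only, since all derivatives are full (two-sided) ones.\<close>

definition C2_on :: "(real^'n) set \<Rightarrow> (real^'n \<Rightarrow> real) \<Rightarrow> bool" where
  "C2_on U f \<longleftrightarrow> (\<forall>x\<in>U. twice_differentiable_at f x) \<and> continuous_on U (hessian f)"

text \<open>Viscosity solutions of \<open>\<Delta>u = F(u)\<close> in the open set \<open>\<Omega>\<close>: the first condition on test functions
  is the subsolution property (\<open>\<phi>\<close> touches \<open>u\<close> from above at \<open>x\<close>), the second one the
  supersolution property (\<open>\<phi>\<close> touches \<open>u\<close> from below at \<open>x\<close>). Values of \<open>u\<close> outside
  \<open>\<Omega>\<close> play no role.\<close>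

definition viscosity_solution ::
    "(real^'n) set \<Rightarrow> (real \<Rightarrow> real) \<Rightarrow> (real^'n \<Rightarrow> real) \<Rightarrow> bool" where
  "viscosity_solution \<Omega> F u \<longleftrightarrow>
     continuous_on \<Omega> u \<and>
     (\<forall>\<phi> U x. open U \<and> U \<subseteq> \<Omega> \<and> x \<in> U \<and> C2_on U \<phi> \<and> \<phi> x = u x \<and> (\<forall>y\<in>U. u y \<le> \<phi> y)
        \<longrightarrow> laplacian \<phi> x \<ge> F (u x)) \<and>
     (\<forall>\<phi> U x. open U \<and> U \<subseteq> \<Omega> \<and> x \<in> U \<and> C2_on U \<phi> \<and> \<phi> x = u x \<and> (\<forall>y\<in>U. \<phi> y \<le> u y)
        \<longrightarrow> laplacian \<phi> x \<le> F (u x))"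

definition pos_part :: "real \<Rightarrow> real" where
  "pos_part t = max t 0"

definition neg_part :: "real \<Rightarrow> real" where
  "neg_part t = pos_part (- t)"

text \<open>The matrix norm is the Euclidean norm of the vector of entries.\<close>

definition branching_point :: "(real^'n \<Rightarrow> real) \<Rightarrow> real^'n \<Rightarrow> bool" where
  "branching_point u x0 \<longleftrightarrow> twice_differentiable_at u x0 \<and>
     u x0 = 0 \<and> norm (gradient u x0) = 0 \<and> norm (hessian u x0) = 0"

text \<open>The norm of \<open>L\<^sup>\<infinity>(\<real>\<^sup>n)\<close> for Lebesgue measure, extended by \<open>\<infinity>\<close> to
  functions that are not essentially bounded.\<close>

definition Linf_norm :: "(real^'n \<Rightarrow> real) \<Rightarrow> ennreal" where
  "Linf_norm u = esssup lebesgue (\<lambda>x. ennreal \<bar>u x\<bar>)"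

text \<open>Pointwise \<open>C\<^sup>s\<close> regularity at a branching point: the relevant Taylor polynomial of \<open>u\<close>
  at \<open>x0\<close> is zero, so only the growth estimate remains.\<close>

definition pointwise_C_growth :: "real \<Rightarrow> (real^'n \<Rightarrow> real) \<Rightarrow> real^'n \<Rightarrow> bool" where
  "pointwise_C_growth s u x0 \<longleftrightarrow>
     (\<exists>K. \<forall>\<^sub>F x in nhds x0. \<bar>u x\<bar> \<le> K * norm (x - x0) powr s)"

end

theory Submission
  imports Defs
begin

text \<open>After rescaling, \<open>u\<close> is bounded by \<open>1\<close>, satisfies \<open>|\<Delta>u| \<le> \<Lambda> |u|\<^sup>\<gamma>\<close> in the viscosity sense, and is
  \<open>o(|x|\<^sup>2)\<close> at the branching point \<open>0\<close>. If \<open>|u| \<le> B |x|\<^sup>q\<close> with \<open>2 \<le> q \<le> \<beta> = 2 / (1 - \<gamma>)\<close>, then \<open>u\<close> is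
  approximated on each dyadic ball by a harmonic polynomial, and telescoping the Taylor expansions of
  these polynomials gives \<open>|u| \<le> C B\<^sup>\<gamma> |x|\<^sup>2\<^sup>+\<^sup>\<gamma>\<^sup>q\<close>: the quadratic parts vanish in the limit, and the cubic
  remainder is of lower order because \<open>\<beta> < 3\<close>, i.e. \<open>\<gamma> < 1/3\<close>. As \<open>C\<close> is uniform in \<open>q\<close>, iterating
  yields the exponent \<open>\<beta>\<close>. The rescaling needs a lower bound on the norm of \<open>u\<close>; if the norm is small,
  the absorption term forces \<open>u\<close> to vanish near the branching point, and the estimate is trivial.\<close>

subsection \<open>Directional derivatives of polynomials\<close>

text \<open>Polynomials carry the whole argument: as test functions they reduce every touching
  argument to algebra, and harmonic polynomials matching boundary data up to a small error replace
  Poisson integrals. One round of the improvement needs two things of the decay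
  \<open>\<gamma> * q\<close> of the right-hand side: it must be positive, so that the second order
  Taylor coefficients can be summed down to the point, and below 1, so that the finest scale
  dominates the sum of the third derivatives. Both hold uniformly for q between 2 and \<beta>, and q
  = 2 is what the branching condition supplies. The estimate is linear in the norm M while the
  equation is not homogeneous: dividing u by M multiplies the right-hand side by
  \<open>M powr (\<gamma> - 1)\<close>, which blows up as M tends to 0. This is the obstacle behind
  the separate treatment of small solutions, the one place where the sign of the nonlinearity
  matters and not only its size.\<close>

lemmas polynomial_linear = real_polynomial_function.intros(1)
  and polynomial_const = real_polynomial_function.intros(2)
  and polynomial_add = real_polynomial_function.intros(3)
  and polynomial_mult = real_polynomial_function.intros(4)

text \<open>The direction comes first, so that \<open>dderiv e\<close> is an operator on functions
  that can be iterated.\<close>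

definition dderiv :: "'a::real_normed_vector \<Rightarrow> ('a \<Rightarrow> real) \<Rightarrow> 'a \<Rightarrow> real" where
  "dderiv e f x = frechet_derivative f (at x) e"

lemma has_derivative_dderiv:
  "real_polynomial_function f \<Longrightarrow> (f has_derivative (\<lambda>e. dderiv e f x)) (at x)"
  unfolding dderiv_def
  using differentiable_at_real_polynomial_function frechet_derivative_works by fastforce

lemma dderiv_eqI: "(f has_derivative f') (at x) \<Longrightarrow> dderiv e f x = f' e"
  unfolding dderiv_def using frechet_derivative_at by metis

lemma dderiv_linear: "bounded_linear f \<Longrightarrow> dderiv e f = (\<lambda>x. f e)"
  using bounded_linear_imp_has_derivative dderiv_eqI by blast

lemma dderiv_const [simp]: "dderiv e (\<lambda>x. c) = (\<lambda>x. 0)"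
  by (rule ext, rule dderiv_eqI[where f'="\<lambda>_. 0"]) auto

lemma dderiv_add:
  assumes "real_polynomial_function f" "real_polynomial_function g"
  shows "dderiv e (\<lambda>x. f x + g x) = (\<lambda>x. dderiv e f x + dderiv e g x)"
  by (rule ext, rule dderiv_eqI, intro has_derivative_add has_derivative_dderiv assms)

lemma dderiv_diff:
  assumes "real_polynomial_function f" "real_polynomial_function g"
  shows "dderiv e (\<lambda>x. f x - g x) = (\<lambda>x. dderiv e f x - dderiv e g x)"
  by (rule ext, rule dderiv_eqI, intro has_derivative_diff has_derivative_dderiv assms)

lemma dderiv_mult:
  assumes "real_polynomial_function f" "real_polynomial_function g"
  shows "dderiv e (\<lambda>x. f x * g x) = (\<lambda>x. f x * dderiv e g x + dderiv e f x * g x)"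
  by (rule ext, rule dderiv_eqI, intro has_derivative_mult has_derivative_dderiv assms)

lemma dderiv_cmult:
  assumes "real_polynomial_function f"
  shows "dderiv e (\<lambda>x. c * f x) = (\<lambda>x. c * dderiv e f x)"
  using dderiv_mult[OF polynomial_const assms] by simp

lemma polynomial_dderiv:
  "real_polynomial_function f \<Longrightarrow> real_polynomial_function (dderiv e f)"
  by (induction f rule: real_polynomial_function.induct)
    (auto simp: dderiv_linear dderiv_add dderiv_mult)

text \<open>Structural induction on the polynomial suffices: linear forms have constant derivatives,
  and the product rule is symmetric in the two directions.\<close>

lemma dderiv_commute:
  assumes "real_polynomial_function f"
  shows "dderiv d (dderiv e f) = dderiv e (dderiv d f)"
  using assms
  by (induction f rule: real_polynomial_function.induct)
    (auto simp: dderiv_linear dderiv_add dderiv_mult polynomial_dderiv real_polynomial_function.intros)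

lemma dderiv_expand:
  fixes f :: "real^'n \<Rightarrow> real"
  assumes "real_polynomial_function f"
  shows "dderiv e f x = (\<Sum>i\<in>UNIV. e $ i * dderiv (axis i 1) f x)"
proof -
  have lin: "linear (\<lambda>e. dderiv e f x)"
    using has_derivative_dderiv[OF assms] has_derivative_linear by blast
  have "dderiv e f x = dderiv (\<Sum>i\<in>UNIV. e $ i *\<^sub>R axis i 1) f x"
    by (simp add: basis_expansion flip: scalar_mult_eq_scaleR)
  also have "\<dots> = (\<Sum>i\<in>UNIV. e $ i * dderiv (axis i 1) f x)"
    by (simp add: linear_sum[OF lin] linear_scale[OF lin])
  finally show ?thesis .
qed

lemma dderiv_line:
  assumes "real_polynomial_function f"
  shows "((\<lambda>t. f (a + t *\<^sub>R e)) has_real_derivative dderiv e f (a + t *\<^sub>R e)) (at t)"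
proof -
  have "((\<lambda>t. f (a + t *\<^sub>R e)) has_derivative (\<lambda>s. dderiv (s *\<^sub>R e) f (a + t *\<^sub>R e))) (at t)"
    by (rule has_derivative_compose[OF _ has_derivative_dderiv[OF assms]])
       (auto intro!: derivative_eq_intros)
  moreover have "dderiv (s *\<^sub>R e) f x = dderiv e f x * s" for s x
    using linear_scale[OF has_derivative_linear[OF has_derivative_dderiv[OF assms, of x]]] by simp
  ultimately show ?thesis by (simp add: has_field_derivative_def)
qed

subsection \<open>The Laplacian of polynomials\<close>

lemma gradient_dderiv: "gradient f = (\<lambda>x. \<chi> i. dderiv (axis i 1) f x)"
  by (simp add: gradient_def dderiv_def fun_eq_iff)

lemma gradient_has_derivative:
  fixes f :: "real^'n \<Rightarrow> real"
  assumes "real_polynomial_function f"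
  shows "(gradient f has_derivative (\<lambda>e. \<chi> i. dderiv e (dderiv (axis i 1) f) x)) (at x)"
proof -
  have "((\<lambda>x. (\<Sum>i\<in>UNIV. dderiv (axis i 1) f x *\<^sub>R axis i 1 :: real^'n)) has_derivative
     (\<lambda>e. (\<Sum>i\<in>UNIV. dderiv e (dderiv (axis i 1) f) x *\<^sub>R axis i 1))) (at x)"
    by (intro has_derivative_sum has_derivative_scaleR_left has_derivative_dderiv
          polynomial_dderiv assms)
  moreover have "(\<Sum>i\<in>UNIV. g i *\<^sub>R axis i 1) = (\<chi> i. g i)" for g :: "'n \<Rightarrow> real"
    using basis_expansion[of "\<chi> i. g i"] by (simp add: scalar_mult_eq_scaleR)
  ultimately show ?thesis by (simp add: gradient_dderiv)
qed

lemma hessian_dderiv: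
  fixes f :: "real^'n \<Rightarrow> real"
  assumes "real_polynomial_function f"
  shows "hessian f x = (\<chi> i j. dderiv (axis j 1) (dderiv (axis i 1) f) x)"
  unfolding hessian_def jacobian_def frechet_derivative_at[OF gradient_has_derivative[OF assms], symmetric]
  by (simp add: matrix_def)

lemma laplacian_eq:
  fixes f :: "real^'n \<Rightarrow> real"
  assumes "real_polynomial_function f"
  shows "laplacian f x = (\<Sum>i\<in>UNIV. dderiv (axis i 1) (dderiv (axis i 1) f) x)"
  unfolding laplacian_def trace_def by (simp add: hessian_dderiv assms)

lemma polynomial_continuous_on: "real_polynomial_function f \<Longrightarrow> continuous_on S f"
  by (meson continuous_at_imp_continuous_on continuous_real_polymonial_function)

text \<open>This makes every polynomial an admissible test function in
  \<open>viscosity_solution\<close>.\<close>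

lemma C2_on_polynomial:
  fixes f :: "real^'n \<Rightarrow> real"
  assumes "real_polynomial_function f"
  shows "C2_on U f"
proof -
  have "twice_differentiable_at f x" for x
    unfolding twice_differentiable_at_def
    using differentiable_at_real_polynomial_function[OF assms] gradient_has_derivative[OF assms]
    by (auto simp: differentiable_def)
  moreover have "continuous_on U (hessian f)"
    using polynomial_continuous_on[OF polynomial_dderiv[OF polynomial_dderiv[OF assms]]]
    by (auto simp: hessian_dderiv assms fun_eq_iff cong: continuous_on_cong
        intro!: continuous_on_vec_lambda)
  ultimately show ?thesis by (simp add: C2_on_def)
qed

lemma laplacian_const [simp]: "laplacian (\<lambda>x::real^'n. c) x = 0"
  by (simp add: laplacian_eq polynomial_const)

lemma laplacian_add:
  fixes f g :: "real^'n \<Rightarrow> real"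
  assumes "real_polynomial_function f" "real_polynomial_function g"
  shows "laplacian (\<lambda>x. f x + g x) x = laplacian f x + laplacian g x"
  using assms by (simp add: laplacian_eq dderiv_add polynomial_dderiv polynomial_add sum.distrib)

lemma laplacian_diff:
  fixes f g :: "real^'n \<Rightarrow> real"
  assumes "real_polynomial_function f" "real_polynomial_function g"
  shows "laplacian (\<lambda>x. f x - g x) x = laplacian f x - laplacian g x"
  using assms by (simp add: laplacian_eq dderiv_diff polynomial_dderiv real_polynomial_function_diff sum_subtractf)

lemma laplacian_mult:
  fixes f g :: "real^'n \<Rightarrow> real"
  assumes f: "real_polynomial_function f" and g: "real_polynomial_function g"
  shows "laplacian (\<lambda>x. f x * g x) x =
    f x * laplacian g x + 2 * (\<Sum>i\<in>UNIV. dderiv (axis i 1) f x * dderiv (axis i 1) g x) + laplacian f x * g x"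
proof -
  have "laplacian (\<lambda>x. f x * g x) x = (\<Sum>i\<in>UNIV. f x * dderiv (axis i 1) (dderiv (axis i 1) g) x +
      2 * (dderiv (axis i 1) f x * dderiv (axis i 1) g x) + dderiv (axis i 1) (dderiv (axis i 1) f) x * g x)"
    using f g
    by (auto simp: laplacian_eq dderiv_mult dderiv_add polynomial_dderiv polynomial_mult
        algebra_simps intro!: sum.cong)
  then show ?thesis
    using f g by (simp add: laplacian_eq sum.distrib sum_distrib_left sum_distrib_right)
qed

lemma laplacian_cmult:
  fixes f :: "real^'n \<Rightarrow> real"
  assumes "real_polynomial_function f"
  shows "laplacian (\<lambda>x. c * f x) x = c * laplacian f x"
  using laplacian_mult[OF polynomial_const assms, of c x] by simp

lemma laplacian_power2:
  fixes f :: "real^'n \<Rightarrow> real"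
  assumes "real_polynomial_function f"
  shows "laplacian (\<lambda>x. (f x)\<^sup>2) x = 2 * f x * laplacian f x + 2 * (\<Sum>i\<in>UNIV. (dderiv (axis i 1) f x)\<^sup>2)"
  using laplacian_mult[OF assms assms, of x] by (simp add: power2_eq_square)

text \<open>Derivatives of harmonic polynomials are thus harmonic, which lets the gradient estimate
  be applied to the derivatives in turn.\<close>

lemma laplacian_dderiv:
  fixes f :: "real^'n \<Rightarrow> real"
  assumes "real_polynomial_function f"
  shows "laplacian (dderiv e f) = dderiv e (laplacian f)"
proof
  fix x
  have "((\<lambda>x. \<Sum>i\<in>UNIV. dderiv (axis i 1) (dderiv (axis i 1) f) x) has_derivative 
     (\<lambda>e. \<Sum>i\<in>UNIV. dderiv e (dderiv (axis i 1) (dderiv (axis i 1) f)) x)) (at x)"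
    by (intro has_derivative_sum has_derivative_dderiv polynomial_dderiv assms)
  then have "dderiv e (laplacian f) x = (\<Sum>i\<in>UNIV. dderiv e (dderiv (axis i 1) (dderiv (axis i 1) f)) x)"
    using dderiv_eqI laplacian_eq[OF assms] by (metis (no_types, lifting) ext)
  then show "laplacian (dderiv e f) x = dderiv e (laplacian f) x"
    by (simp add: laplacian_eq polynomial_dderiv assms dderiv_commute[of _ _ e] )
qed

lemma polynomial_inner_self: "real_polynomial_function (\<lambda>x::real^'n. x \<bullet> x)"
proof -
  have "real_polynomial_function (\<lambda>x::real^'n. \<Sum>i\<in>UNIV. x $ i * x $ i)"
    by (intro real_polynomial_function_sum polynomial_mult
        polynomial_linear bounded_linear_vec_nth) auto
  then show ?thesis by (simp add: inner_vec_def)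
qed

lemma dderiv_inner_self: "dderiv e (\<lambda>x::real^'n. x \<bullet> x) x = 2 * (e \<bullet> x)"
proof (rule dderiv_eqI)
  show "((\<lambda>x. x \<bullet> x) has_derivative (\<lambda>e. 2 * (e \<bullet> x))) (at x)"
    by (auto intro!: derivative_eq_intros simp: inner_commute)
qed

lemma laplacian_inner_self: "laplacian (\<lambda>x::real^'n. x \<bullet> x) x = 2 * real CARD('n)"
proof -
  have "dderiv e (dderiv e (\<lambda>x::real^'n. x \<bullet> x)) x = 2 * (e \<bullet> e)" for e
  proof -
    have "dderiv e (\<lambda>x. x \<bullet> x) = (\<lambda>x. (2 *\<^sub>R e) \<bullet> x)"
      by (simp add: dderiv_inner_self fun_eq_iff)
    then show ?thesis by (simp only: dderiv_linear bounded_linear_inner_right) simp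
  qed
  then show ?thesis
    by (simp add: laplacian_eq polynomial_inner_self inner_axis_axis)
qed

subsection \<open>Maximum and comparison principles\<close>

text \<open>Polynomial test functions suffice, since all barriers below are polynomials; \<open>\<eta>\<close> bounds the right-hand side.\<close>

definition visc_sub :: "real \<Rightarrow> real \<Rightarrow> (real^'n \<Rightarrow> real) \<Rightarrow> bool" where
  "visc_sub r \<eta> v \<longleftrightarrow> (\<forall>\<phi> U x. real_polynomial_function \<phi> \<and> open U \<and> U \<subseteq> ball 0 r \<and> x \<in> U \<and>
     \<phi> x = v x \<and> (\<forall>y\<in>U. v y \<le> \<phi> y) \<longrightarrow> - \<eta> \<le> laplacian \<phi> x)"

lemma dderiv2_nonneg_at_local_min:
  assumes f: "real_polynomial_function f" and U: "open U" "x \<in> U" and min: "\<And>y. y \<in> U \<Longrightarrow> f x \<le> f y"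
  shows "0 \<le> dderiv e (dderiv e f) x"
proof (rule ccontr)
  assume "\<not> 0 \<le> dderiv e (dderiv e f) x"
  then have neg: "dderiv e (dderiv e f) x < 0" by simp
  define g where "g t = f (x + t *\<^sub>R e)" for t
  define g' where "g' t = dderiv e f (x + t *\<^sub>R e)" for t
  have dg: "(g has_real_derivative g' t) (at t)" for t
    unfolding g_def g'_def by (rule dderiv_line[OF f])
  have "open ((\<lambda>t. x + t *\<^sub>R e) -` U)"
    by (rule open_vimage[OF U(1)]) (intro continuous_intros)
  moreover have "0 \<in> (\<lambda>t. x + t *\<^sub>R e) -` U" using U by simp
  ultimately obtain d where "d > 0" "ball 0 d \<subseteq> (\<lambda>t. x + t *\<^sub>R e) -` U"
    using open_contains_ball by blast
  then have d: "d > 0" "\<And>t. \<bar>t\<bar> < d \<Longrightarrow> x + t *\<^sub>R e \<in> U"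
    by (auto simp: subset_iff)
  have gmin: "g 0 \<le> g t" if "\<bar>t\<bar> < d" for t
    using min[OF d(2)[OF that]] by (simp add: g_def)
  have "g' 0 = 0"
    by (rule DERIV_local_min[OF dg d(1)]) (use gmin in auto)
  moreover have "(g' has_real_derivative dderiv e (dderiv e f) x) (at 0)"
    unfolding g'_def using dderiv_line[OF polynomial_dderiv[OF f], where a=x and e=e and t=0] by simp
  ultimately obtain d' where d': "d' > 0" "\<And>h. 0 < h \<Longrightarrow> h < d' \<Longrightarrow> g' h < 0"
    using DERIV_neg_dec_right[OF _ neg] by force
  \<comment> \<open>At \<open>s\<close> two facts collide: the point is still in \<open>U\<close>,
    so \<open>g s\<close> is at least \<open>g 0\<close>, while \<open>g'\<close> is negative
    between 0 and \<open>s\<close>, so the mean value theorem makes \<open>g s\<close>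
    smaller.\<close>
  define s where "s = min d d' / 2"
  have s: "0 < s" "s < d" "s < d'" using d d' by (auto simp: s_def)
  obtain z where "0 < z" "z < s" "g s - g 0 = (s - 0) * g' z"
    using MVT2[of 0 s g g'] s dg by blast
  moreover have "g 0 \<le> g s" using gmin s by simp
  moreover have "g' z < 0" using d' s calculation by simp
  ultimately show False using s by (smt (verit) mult_pos_neg)
qed

lemma laplacian_nonneg_at_local_min:
  fixes f :: "real^'n \<Rightarrow> real"
  assumes "real_polynomial_function f" "open U" "x \<in> U" "\<And>y. y \<in> U \<Longrightarrow> f x \<le> f y"
  shows "0 \<le> laplacian f x"
  unfolding laplacian_eq[OF assms(1)]
  using dderiv2_nonneg_at_local_min[OF assms] by (simp add: sum_nonneg)

lemma visc_sub_polynomial: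
  fixes f :: "real^'n \<Rightarrow> real"
  assumes f: "real_polynomial_function f" and sub: "\<And>x. x \<in> ball 0 r \<Longrightarrow> - \<eta> \<le> laplacian f x"
  shows "visc_sub r \<eta> f"
  unfolding visc_sub_def
proof (intro allI impI, elim conjE)
  fix \<phi> :: "real^'n \<Rightarrow> real" and U x
  assume *: "real_polynomial_function \<phi>" "open U" "U \<subseteq> ball 0 r" "x \<in> U" "\<phi> x = f x" "\<forall>y\<in>U. f y \<le> \<phi> y"
  have "0 \<le> laplacian (\<lambda>y. \<phi> y - f y) x"
    by (rule laplacian_nonneg_at_local_min[of _ U]) (use * f in auto)
  moreover have "- \<eta> \<le> laplacian f x" using sub * by blast
  ultimately show "- \<eta> \<le> laplacian \<phi> x" using * f by (simp add: laplacian_diff)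
qed

text \<open>At an interior maximum of \<open>v - \<psi>\<close>, a vertical shift of
  \<open>\<psi>\<close> touches \<open>v\<close> from above, and its Laplacian is too small for a
  test function. So the maximum lies on the sphere.\<close>

lemma visc_sub_le_polynomial:
  fixes v :: "real^'n \<Rightarrow> real"
  assumes v: "visc_sub r \<eta> v" "continuous_on (cball 0 r) v"
    and \<psi>: "real_polynomial_function \<psi>" "\<And>x. x \<in> ball 0 r \<Longrightarrow> laplacian \<psi> x < - \<eta>"
    and bd: "\<And>x. norm x = r \<Longrightarrow> v x \<le> \<psi> x"
    and x: "norm x \<le> r"
  shows "v x \<le> \<psi> x"
proof -
  have "continuous_on (cball 0 r) (\<lambda>x. v x - \<psi> x)"
    by (intro continuous_intros v polynomial_continuous_on \<psi>)
  then obtain z where z: "z \<in> cball 0 r" "\<And>y. y \<in> cball 0 r \<Longrightarrow> v y - \<psi> y \<le> v z - \<psi> z"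
    using continuous_attains_sup[of "cball 0 r" "\<lambda>x. v x - \<psi> x"] x by fastforce
  have "\<not> z \<in> ball 0 r"
  proof
    assume zb: "z \<in> ball 0 r"
    let ?\<phi> = "\<lambda>y. \<psi> y + (v z - \<psi> z)"
    have "real_polynomial_function ?\<phi>" using \<psi> by (intro polynomial_add polynomial_const)
    moreover have "?\<phi> z = v z" "\<forall>y\<in>ball 0 r. v y \<le> ?\<phi> y" using z(2) by (auto simp: algebra_simps)
    ultimately have "- \<eta> \<le> laplacian ?\<phi> z"
      using v(1) zb unfolding visc_sub_def by (meson open_ball subset_refl)
    then show False using \<psi>(2)[OF zb] \<psi>(1) by (simp add: laplacian_add polynomial_const)
  qed
  then have "norm z = r" using z by auto
  then show ?thesis using bd[of z] z(2)[of x] x by simp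
qed

text \<open>In its uses \<open>r\<close> is the square of the radius: the barrier equals
  \<open>c\<close> on the sphere and lies above \<open>c\<close> inside.\<close>

lemma polynomial_quadratic_barrier:
  "real_polynomial_function (\<lambda>x::real^'n. c + k * (r - x \<bullet> x))"
  by (intro polynomial_add polynomial_mult polynomial_const real_polynomial_function_diff polynomial_inner_self)

lemma laplacian_quadratic_barrier:
  "laplacian (\<lambda>x::real^'n. c + k * (r - x \<bullet> x)) x = - (2 * real CARD('n) * k)"
  by (simp add: laplacian_add laplacian_cmult laplacian_diff polynomial_const polynomial_mult
      real_polynomial_function_diff polynomial_inner_self laplacian_inner_self)

text \<open>Comparison requires a strict inequality, so a paraboloid of height at most
  \<open>e\<close> is added to \<open>S\<close>, and \<open>e\<close> is arbitrary.\<close>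

lemma maximum_principle:
  fixes f :: "real^'n \<Rightarrow> real"
  assumes f: "real_polynomial_function f" and sub: "\<And>x. x \<in> ball 0 r \<Longrightarrow> 0 \<le> laplacian f x"
    and bd: "\<And>x. norm x = r \<Longrightarrow> f x \<le> S" and x: "norm x \<le> r"
  shows "f x \<le> S"
proof (rule field_le_epsilon)
  fix e :: real assume e: "e > 0"
  have r: "r \<ge> 0" using x norm_ge_zero order_trans by blast
  \<comment> \<open>The summand 1 covers the degenerate radius \<open>r = 0\<close>.\<close>
  define k where "k = e / (r\<^sup>2 + 1)"
  have r1: "r\<^sup>2 + 1 > 0" by (simp add: add_nonneg_pos)
  have k: "k > 0" "k * r\<^sup>2 \<le> e"
    using e r1 by (simp_all add: k_def divide_le_eq mult_left_mono)
  have "f x \<le> S + k * (r\<^sup>2 - x \<bullet> x)"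
  proof (rule visc_sub_le_polynomial[where r=r and \<eta>=0 and v=f])
    show "visc_sub r 0 f" using visc_sub_polynomial[OF f] sub by simp
    show "f y \<le> S + k * (r\<^sup>2 - y \<bullet> y)" if "norm y = r" for y
      using bd[OF that] that by (simp add: dot_square_norm)
  qed (use f x k in \<open>simp_all add: polynomial_quadratic_barrier laplacian_quadratic_barrier
       polynomial_continuous_on\<close>)
  moreover have "k * (r\<^sup>2 - x \<bullet> x) \<le> k * r\<^sup>2" using k by (intro mult_left_mono) auto
  ultimately show "f x \<le> S + e" using k(2) by linarith
qed

subsection \<open>Interior derivative estimates for harmonic polynomials\<close>

text \<open>Bernstein's method: for harmonic \<open>w\<close>, a cutoff \<open>\<phi>\<close> and \<open>g = \<partial>\<^sub>e w\<close>, the function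
  \<open>\<phi>\<^sup>2 g\<^sup>2 + \<lambda> w\<^sup>2\<close> is subharmonic for large \<open>\<lambda>\<close>.\<close>

lemma Bernstein_subharmonic:
  fixes w :: "real^'n \<Rightarrow> real"
  assumes w: "real_polynomial_function w" "\<And>x. laplacian w x = 0" and x: "norm x \<le> r"
  shows "0 \<le> laplacian (\<lambda>x. ((r\<^sup>2 - x \<bullet> x) * dderiv e w x)\<^sup>2 +
      ((2 * real CARD('n) + 12) * r\<^sup>2 * (norm e)\<^sup>2) * (w x)\<^sup>2) x"
proof -
  define \<phi> where "\<phi> = (\<lambda>x::real^'n. r\<^sup>2 - x \<bullet> x)"
  define g where "g = dderiv e w"
  define n where "n = real CARD('n)"
  \<comment> \<open>Differentiating the cutoff loses at most
    \<open>(4 * n + 24) * r\<^sup>2 * (g x)\<^sup>2\<close>, and \<open>(g x)\<^sup>2\<close> is at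
    most \<open>(norm e)\<^sup>2\<close> times the squared gradient of \<open>w\<close>. As the
    Laplacian of \<open>(w x)\<^sup>2\<close> is twice that squared gradient, half of the
    coefficient is enough.\<close>
  define lam where "lam = (2 * n + 12) * r\<^sup>2 * (norm e)\<^sup>2"
  define D where "D i = dderiv (axis i (1::real)) \<phi> x" for i :: 'n
  define G where "G i = dderiv (axis i (1::real)) g x" for i :: 'n
  have p\<phi>: "real_polynomial_function \<phi>"
    unfolding \<phi>_def by (intro real_polynomial_function_diff polynomial_const polynomial_inner_self)
  have pg: "real_polynomial_function g" unfolding g_def by (rule polynomial_dderiv[OF w(1)])
  have lg: "laplacian g x = 0"
  proof -
    have "laplacian w = (\<lambda>x. 0)" using w(2) by auto
    then show ?thesis by (simp add: g_def laplacian_dderiv w(1))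
  qed
  have l\<phi>: "laplacian \<phi> x = - (2 * n)"
    unfolding \<phi>_def n_def by (simp add: laplacian_diff polynomial_const polynomial_inner_self laplacian_inner_self)
  have Di: "D i = - (2 * x $ i)" for i
    unfolding D_def \<phi>_def
    by (simp add: dderiv_diff polynomial_const polynomial_inner_self dderiv_inner_self inner_axis' )
  have D2: "(\<Sum>i\<in>UNIV. (D i)\<^sup>2) \<le> 4 * r\<^sup>2"
  proof -
    have "(\<Sum>i\<in>UNIV. (D i)\<^sup>2) = 4 * (x \<bullet> x)"
      by (simp add: Di inner_vec_def power2_eq_square sum_distrib_left)
    also have "x \<bullet> x \<le> r\<^sup>2" using x by (simp add: dot_square_norm power_mono)
    finally show ?thesis by simp
  qed
  have pf: "real_polynomial_function (\<lambda>x. \<phi> x * g x)" using p\<phi> pg by (rule polynomial_mult)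
  have "laplacian (\<lambda>x. (\<phi> x * g x)\<^sup>2) x =
     2 * (\<phi> x * g x) * (2 * (\<Sum>i\<in>UNIV. D i * G i) - 2 * n * g x) + 2 * (\<Sum>i\<in>UNIV. (\<phi> x * G i + D i * g x)\<^sup>2)"
    by (simp add: laplacian_power2[OF pf] laplacian_mult[OF p\<phi> pg] lg l\<phi> dderiv_mult[OF p\<phi> pg] D_def G_def)
  also have "\<dots> = (\<Sum>i\<in>UNIV. 4 * (\<phi> x * G i) * (D i * g x) + 2 * (\<phi> x * G i + D i * g x)\<^sup>2) - 4 * n * \<phi> x * (g x)\<^sup>2"
    by (simp add: sum.distrib sum_distrib_left algebra_simps power2_eq_square)
  also have "\<dots> \<ge> (\<Sum>i\<in>UNIV. - 6 * (D i * g x)\<^sup>2) - 4 * n * \<phi> x * (g x)\<^sup>2"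
  proof -
    \<comment> \<open>The two sides differ by \<open>2 * (a + 2 * b)\<^sup>2\<close>. With
      \<open>a = \<phi> x * G i\<close> and \<open>b = D i * g x\<close> this absorbs all second
      derivatives of \<open>w\<close>.\<close>
    have "- 6 * b\<^sup>2 \<le> 4 * a * b + 2 * (a + b)\<^sup>2" for a b :: real
      using zero_le_power2[of "a + 2 * b"] by (simp add: power2_eq_square algebra_simps)
    then show ?thesis by (auto intro!: sum_mono)
  qed
  also have "(\<Sum>i\<in>UNIV. - 6 * (D i * g x)\<^sup>2) = - 6 * (g x)\<^sup>2 * (\<Sum>i\<in>UNIV. (D i)\<^sup>2)"
    by (simp add: sum_distrib_left power_mult_distrib sum_negf algebra_simps)
  finally have 1: "laplacian (\<lambda>x. (\<phi> x * g x)\<^sup>2) x \<ge> - 6 * (g x)\<^sup>2 * (\<Sum>i\<in>UNIV. (D i)\<^sup>2) - 4 * n * \<phi> x * (g x)\<^sup>2" .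
  have "(g x)\<^sup>2 * (\<Sum>i\<in>UNIV. (D i)\<^sup>2) \<le> (g x)\<^sup>2 * (4 * r\<^sup>2)"
    using D2 by (intro mult_left_mono) auto
  moreover have "n * \<phi> x * (g x)\<^sup>2 \<le> n * r\<^sup>2 * (g x)\<^sup>2"
    by (intro mult_right_mono mult_left_mono) (auto simp: \<phi>_def n_def)
  ultimately have 2: "laplacian (\<lambda>x. (\<phi> x * g x)\<^sup>2) x \<ge> - ((4 * n + 24) * r\<^sup>2 * (g x)\<^sup>2)"
    using 1 by (simp add: algebra_simps)
  have "(g x)\<^sup>2 \<le> (\<Sum>i\<in>UNIV. (e $ i)\<^sup>2) * (\<Sum>i\<in>UNIV. (dderiv (axis i 1) w x)\<^sup>2)"
    unfolding g_def dderiv_expand[OF w(1), of e] by (rule Cauchy_Schwarz_ineq_sum)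
  also have "(\<Sum>i\<in>UNIV. (e $ i)\<^sup>2) = (norm e)\<^sup>2"
    by (simp only: power2_norm_eq_inner inner_vec_def) (simp add: power2_eq_square)
  finally have "(4 * n + 24) * r\<^sup>2 * (g x)\<^sup>2 \<le> (4 * n + 24) * r\<^sup>2 * ((norm e)\<^sup>2 * (\<Sum>i\<in>UNIV. (dderiv (axis i 1) w x)\<^sup>2))"
    by (intro mult_left_mono) (auto simp: n_def)
  also have "\<dots> = lam * laplacian (\<lambda>x. (w x)\<^sup>2) x"
    by (simp add: laplacian_power2 w lam_def algebra_simps)
  finally have 3: "laplacian (\<lambda>x. (\<phi> x * g x)\<^sup>2) x + lam * laplacian (\<lambda>x. (w x)\<^sup>2) x \<ge> 0"
    using 2 by simp
  have "laplacian (\<lambda>x. (\<phi> x * g x)\<^sup>2 + lam * (w x)\<^sup>2) x = 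
      laplacian (\<lambda>x. (\<phi> x * g x)\<^sup>2) x + lam * laplacian (\<lambda>x. (w x)\<^sup>2) x"
    using pf w(1) by (simp add: laplacian_add laplacian_cmult polynomial_mult polynomial_const real_polynomial_function_power)
  with 3 show ?thesis by (simp add: \<phi>_def g_def lam_def n_def)
qed

text \<open>Twice the factor \<open>2 * n + 12\<close> of the cutoff argument. Being at least 1, it
  is below its own square, so the squared gradient estimate can be written as a perfect
  square.\<close>

definition Bernstein_const :: "'n::finite itself \<Rightarrow> real" where
  "Bernstein_const _ = 4 * real CARD('n) + 24"

text \<open>The cutoff vanishes on the sphere, so there, and by the maximum principle inside,
  Bernstein's function is at most \<open>lam * S\<^sup>2\<close>. On the half ball the cutoff is at
  least \<open>3 / 4 * r\<^sup>2\<close>, which leaves a bound on the derivative.\<close>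

lemma harmonic_dderiv_bound:
  fixes w :: "real^'n \<Rightarrow> real"
  assumes w: "real_polynomial_function w" "\<And>x. laplacian w x = 0" and r: "r > 0"
    and bd: "\<And>x. norm x \<le> r \<Longrightarrow> \<bar>w x\<bar> \<le> S" and x: "norm x \<le> r / 2"
  shows "\<bar>dderiv e w x\<bar> \<le> Bernstein_const TYPE('n) * S * (norm e / r)"
proof -
  define K where "K = Bernstein_const TYPE('n)"
  define lam where "lam = (2 * real CARD('n) + 12) * r\<^sup>2 * (norm e)\<^sup>2"
  have K: "K \<ge> 1" "2 * real CARD('n) + 12 = K / 2" by (simp_all add: K_def Bernstein_const_def)
  have S: "S \<ge> 0" using bd[of 0] r by (smt (verit) norm_zero)
  have lam: "lam \<ge> 0" by (simp add: lam_def)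
  have wS: "(w y)\<^sup>2 \<le> S\<^sup>2" if "norm y \<le> r" for y
    using bd[OF that] S by (simp add: abs_le_square_iff[symmetric])
  have "((r\<^sup>2 - x \<bullet> x) * dderiv e w x)\<^sup>2 + lam * (w x)\<^sup>2 \<le> lam * S\<^sup>2"
  proof (rule maximum_principle)
    show "real_polynomial_function (\<lambda>x. ((r\<^sup>2 - x \<bullet> x) * dderiv e w x)\<^sup>2 + lam * (w x)\<^sup>2)"
      by (intro polynomial_add polynomial_mult polynomial_const polynomial_inner_self w polynomial_dderiv
           real_polynomial_function_power real_polynomial_function_diff)
    show "0 \<le> laplacian (\<lambda>x. ((r\<^sup>2 - x \<bullet> x) * dderiv e w x)\<^sup>2 + lam * (w x)\<^sup>2) x" if "x \<in> ball 0 r" for x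
      unfolding lam_def by (rule Bernstein_subharmonic[OF w]) (use that in auto)
    show "((r\<^sup>2 - x \<bullet> x) * dderiv e w x)\<^sup>2 + lam * (w x)\<^sup>2 \<le> lam * S\<^sup>2" if "norm x = r" for x
      using that lam wS[of x] by (simp add: dot_square_norm mult_left_mono)
  qed (use x r in auto)
  then have 1: "((r\<^sup>2 - x \<bullet> x) * dderiv e w x)\<^sup>2 \<le> lam * S\<^sup>2"
    using lam by (smt (verit) mult_nonneg_nonneg zero_le_power2)
  have "x \<bullet> x \<le> (r / 2)\<^sup>2" using x by (simp add: dot_square_norm power_mono)
  then have "3 / 4 * r\<^sup>2 \<le> r\<^sup>2 - x \<bullet> x" by (simp add: power2_eq_square)
  then have "(3 / 4 * r\<^sup>2)\<^sup>2 \<le> (r\<^sup>2 - x \<bullet> x)\<^sup>2" by (intro power_mono) auto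
  then have "(3 / 4 * r\<^sup>2)\<^sup>2 * (dderiv e w x)\<^sup>2 \<le> lam * S\<^sup>2"
    using 1 by (smt (verit) mult_right_mono power_mult_distrib zero_le_power2)
  then have "(dderiv e w x)\<^sup>2 * (r\<^sup>2 * r\<^sup>2) \<le> (16 / 9) * (K / 2) * r\<^sup>2 * (norm e)\<^sup>2 * S\<^sup>2"
    unfolding lam_def K(2) by (simp add: power2_eq_square algebra_simps)
  also have "\<dots> \<le> K * r\<^sup>2 * (norm e)\<^sup>2 * S\<^sup>2"
    using K by (intro mult_right_mono) auto
  also have "\<dots> \<le> K\<^sup>2 * r\<^sup>2 * (norm e)\<^sup>2 * S\<^sup>2"
    using K by (intro mult_right_mono) (auto simp: power2_eq_square)
  also have "\<dots> = (K * S * (norm e / r))\<^sup>2 * (r\<^sup>2 * r\<^sup>2)"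
    using r by (simp add: power2_eq_square field_simps)
  finally have "(dderiv e w x)\<^sup>2 \<le> (K * S * (norm e / r))\<^sup>2"
    using r by simp
  then show ?thesis
    using K S r by (simp add: abs_le_square_iff[symmetric] K_def)
qed

subsection \<open>Harmonic polynomials with prescribed boundary values\<close>

text \<open>Serves to correct a power of a linear form to a harmonic polynomial without changing it
  on the sphere of radius \<open>r\<close>.\<close>

definition poisson_solvable :: "real \<Rightarrow> (real^'n \<Rightarrow> real) \<Rightarrow> bool" where
  "poisson_solvable r f \<longleftrightarrow> (\<exists>w. real_polynomial_function w \<and> (\<forall>x. norm x = r \<longrightarrow> w x = 0) \<and>
     (\<forall>x. laplacian w x = f x))"

lemma poisson_solvable_add:
  assumes "poisson_solvable r f" "poisson_solvable r g"
  shows "poisson_solvable r (\<lambda>x. f x + g x)"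
proof -
  obtain w where w: "real_polynomial_function w" "\<forall>x. norm x = r \<longrightarrow> w x = 0" "\<forall>x. laplacian w x = f x"
    using assms unfolding poisson_solvable_def by blast
  obtain w' where w': "real_polynomial_function w'" "\<forall>x. norm x = r \<longrightarrow> w' x = 0" "\<forall>x. laplacian w' x = g x"
    using assms unfolding poisson_solvable_def by blast
  have "real_polynomial_function (\<lambda>x. w x + w' x)" using w w' by (intro polynomial_add)
  with w w' show ?thesis unfolding poisson_solvable_def
    by (intro exI[of _ "\<lambda>x. w x + w' x"]) (simp add: laplacian_add)
qed

lemma poisson_solvable_cmult:
  assumes "poisson_solvable r f" shows "poisson_solvable r (\<lambda>x. c * f x)"
proof -
  obtain w where w: "real_polynomial_function w" "\<forall>x. norm x = r \<longrightarrow> w x = 0" "\<forall>x. laplacian w x = f x"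
    using assms unfolding poisson_solvable_def by blast
  have "real_polynomial_function (\<lambda>x. c * w x)" using w by (intro polynomial_mult polynomial_const)
  with w show ?thesis unfolding poisson_solvable_def
    by (intro exI[of _ "\<lambda>x. c * w x"]) (simp add: laplacian_cmult)
qed

text \<open>This family contains the powers of a linear form, and its span is stable under the
  Laplacian and under multiplication by \<open>x \<bullet> x\<close>.\<close>

definition ridge :: "real^'n \<Rightarrow> nat \<Rightarrow> nat \<Rightarrow> real^'n \<Rightarrow> real" where
  "ridge a m j x = (x \<bullet> x) ^ j * (a \<bullet> x) ^ m"

lemma polynomial_inner_left: "real_polynomial_function (\<lambda>x::real^'n. a \<bullet> x)"
  by (rule polynomial_linear) (rule bounded_linear_inner_right)

lemma polynomial_ridge: "real_polynomial_function (ridge a m j)"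
  unfolding ridge_def
  by (intro polynomial_mult real_polynomial_function_power polynomial_inner_self polynomial_inner_left)

lemma dderiv_inner_power:
  "dderiv e (\<lambda>x::real^'n. (a \<bullet> x) ^ m) x = real m * (a \<bullet> e) * (a \<bullet> x) ^ (m - 1)"
  by (rule dderiv_eqI) (auto intro!: derivative_eq_intros simp: algebra_simps)

lemma dderiv_norm_power:
  "dderiv e (\<lambda>x::real^'n. (x \<bullet> x) ^ j) x = 2 * real j * (x \<bullet> e) * (x \<bullet> x) ^ (j - 1)"
  by (rule dderiv_eqI) (auto intro!: derivative_eq_intros simp: algebra_simps inner_commute)

text \<open>The truncated exponent \<open>m - 2\<close> is harmless: for \<open>m < 2\<close> the
  factor \<open>real m * (real m - 1)\<close> is zero. The same holds for \<open>j - 1\<close> and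
  the factor \<open>real j\<close> below.\<close>

lemma laplacian_inner_power:
  "laplacian (\<lambda>x::real^'n. (a \<bullet> x) ^ m) x = real m * (real m - 1) * (a \<bullet> a) * (a \<bullet> x) ^ (m - 2)"
proof -
  have p: "real_polynomial_function (\<lambda>x. (a \<bullet> x) ^ k)" for k
    by (intro real_polynomial_function_power polynomial_inner_left)
  have "dderiv e (dderiv e (\<lambda>x. (a \<bullet> x) ^ m)) x = real m * (real m - 1) * (a \<bullet> e)\<^sup>2 * (a \<bullet> x) ^ (m - 2)" for e
  proof -
    have "dderiv e (\<lambda>x. (a \<bullet> x) ^ m) = (\<lambda>x. (real m * (a \<bullet> e)) * (a \<bullet> x) ^ (m - 1))"
      by (simp add: dderiv_inner_power fun_eq_iff)
    then have "dderiv e (dderiv e (\<lambda>x. (a \<bullet> x) ^ m)) x =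
        (real m * (a \<bullet> e)) * (real (m - 1) * (a \<bullet> e) * (a \<bullet> x) ^ (m - 1 - 1))"
      by (simp only: dderiv_cmult[OF p] dderiv_inner_power)
    then show ?thesis by (cases m) (auto simp: power2_eq_square numeral_2_eq_2)
  qed
  moreover have "(\<Sum>i\<in>UNIV. (a \<bullet> axis i 1)\<^sup>2) = a \<bullet> a"
    by (simp only: inner_axis) (simp add: inner_vec_def power2_eq_square)
  ultimately show ?thesis
    by (simp add: laplacian_eq p flip: sum_distrib_left sum_distrib_right)
qed

lemma laplacian_norm_power:
  "laplacian (\<lambda>x::real^'n. (x \<bullet> x) ^ j) x =
     2 * real j * (real CARD('n) + 2 * real j - 2) * (x \<bullet> x) ^ (j - 1)"
proof (induction j)
  case (Suc j)
  have p: "real_polynomial_function (\<lambda>x::real^'n. (x \<bullet> x) ^ j)"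
    by (intro real_polynomial_function_power polynomial_inner_self)
  have "(\<Sum>i\<in>UNIV. dderiv (axis i 1) (\<lambda>x::real^'n. x \<bullet> x) x * dderiv (axis i 1) (\<lambda>x. (x \<bullet> x) ^ j) x)
      = (\<Sum>i\<in>UNIV. (4 * real j * (x \<bullet> x) ^ (j - 1)) * (x $ i * x $ i))"
    by (simp add: dderiv_inner_self dderiv_norm_power inner_axis inner_axis' algebra_simps)
  also have "\<dots> = 4 * real j * (x \<bullet> x) ^ (j - 1) * (x \<bullet> x)"
    by (simp add: inner_vec_def flip: sum_distrib_left)
  also have "\<dots> = 4 * real j * (x \<bullet> x) ^ j" by (cases j) auto
  finally have 1: "(\<Sum>i\<in>UNIV. dderiv (axis i 1) (\<lambda>x::real^'n. x \<bullet> x) x * dderiv (axis i 1) (\<lambda>x. (x \<bullet> x) ^ j) x)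
     = 4 * real j * (x \<bullet> x) ^ j" .
  have "(x \<bullet> x) * laplacian (\<lambda>x::real^'n. (x \<bullet> x) ^ j) x =
     2 * real j * (real CARD('n) + 2 * real j - 2) * (x \<bullet> x) ^ j"
    unfolding Suc.IH by (cases j) auto
  then show ?case
    by (simp add: laplacian_mult[OF polynomial_inner_self p] 1 laplacian_inner_self)
       (simp add: algebra_simps)
qed simp

text \<open>In the mixed term of the product rule the sum over the coordinates restores the lost
  power of \<open>a \<bullet> x\<close>. This term accounts for the summand
  \<open>2 * real m\<close> of the first coefficient.\<close>

lemma laplacian_ridge:
  fixes a :: "real^'n"
  shows "laplacian (ridge a m j) x =
     2 * real j * (real CARD('n) + 2 * real m + 2 * real j - 2) * ridge a m (j - 1) x +
     (a \<bullet> a) * real m * (real m - 1) * ridge a (m - 2) j x"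
proof -
  have p: "real_polynomial_function (\<lambda>x::real^'n. (x \<bullet> x) ^ j)" "real_polynomial_function (\<lambda>x. (a \<bullet> x) ^ m)"
    by (intro real_polynomial_function_power polynomial_inner_self polynomial_inner_left)+
  have "(\<Sum>i\<in>UNIV. dderiv (axis i 1) (\<lambda>x::real^'n. (x \<bullet> x) ^ j) x * dderiv (axis i 1) (\<lambda>x. (a \<bullet> x) ^ m) x)
     = (\<Sum>i\<in>UNIV. (2 * real j * real m * (x \<bullet> x) ^ (j - 1) * (a \<bullet> x) ^ (m - 1)) * (a $ i * x $ i))"
    by (simp add: dderiv_inner_power dderiv_norm_power inner_axis algebra_simps)
  also have "\<dots> = 2 * real j * real m * (x \<bullet> x) ^ (j - 1) * (a \<bullet> x) ^ (m - 1) * (a \<bullet> x)"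
    by (simp add: inner_vec_def flip: sum_distrib_left)
  also have "\<dots> = 2 * real j * real m * ridge a m (j - 1) x"
    by (cases m) (auto simp: ridge_def)
  finally have "laplacian (\<lambda>x. (x \<bullet> x) ^ j * (a \<bullet> x) ^ m) x =
     2 * real j * (real CARD('n) + 2 * real m + 2 * real j - 2) * ridge a m (j - 1) x +
     (a \<bullet> a) * real m * (real m - 1) * ridge a (m - 2) j x"
    by (simp add: laplacian_mult[OF p] laplacian_norm_power laplacian_inner_power)
       (simp add: ridge_def algebra_simps)
  then show ?thesis by (simp add: ridge_def[abs_def])
qed

text \<open>Apply the Laplacian to \<open>(r\<^sup>2 - |x|\<^sup>2) |x|\<^sup>2\<^sup>j (a\<bullet>x)\<^sup>m\<close>: up to a nonzero factor, the result is
  \<open>|x|\<^sup>2\<^sup>j (a\<bullet>x)\<^sup>m\<close> plus terms with smaller \<open>m\<close>, or equal \<open>m\<close> and smaller \<open>j\<close>.\<close>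

lemma poisson_solvable_ridge:
  fixes a :: "real^'n"
  shows "poisson_solvable r (ridge a m j)"
proof (induction m arbitrary: j rule: less_induct)
  case (less m)
  \<comment> \<open>The coefficient stays in the claim so that for \<open>m < 2\<close>, where
    \<open>m - 2\<close> need not be smaller than \<open>m\<close>, the function is zero.\<close>
  have low_m: "poisson_solvable r (\<lambda>x. c * (real m * (real m - 1)) * ridge a (m - 2) k x)" for c k
  proof (cases "m < 2")
    case True
    then have "real m * (real m - 1) = 0" by (cases m) auto
    then show ?thesis
      unfolding poisson_solvable_def by (intro exI[of _ "\<lambda>x. 0"]) (simp add: polynomial_const)
  qed (use less[of "m - 2" k] in \<open>auto intro: poisson_solvable_cmult\<close>)
  \<comment> \<open>The factor \<open>real j\<close> turns the premise into a statement about the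
    zero function at \<open>j = 0\<close>, so one argument serves both cases of the induction on
    \<open>j\<close>.\<close>
  have step: "poisson_solvable r (ridge a m j)"
    if low_j: "\<And>c. poisson_solvable r (\<lambda>x. c * real j * ridge a m (j - 1) x)" for j
  proof -
    define n where "n = real CARD('n)"
    define D where "D = 2 * real (Suc j) * (n + 2 * real m + 2 * real j)"
    define E where "E = (a \<bullet> a) * (real m * (real m - 1))"
    define w where "w = (\<lambda>x. r\<^sup>2 * ridge a m j x - ridge a m (Suc j) x)"
    have D: "D \<noteq> 0"
    proof -
      have "n \<ge> 1" by (simp add: n_def Suc_le_eq)
      then show ?thesis unfolding D_def by (simp add: add_nonneg_pos add_pos_nonneg)
    qed
    have pw: "real_polynomial_function w"
      unfolding w_def by (intro real_polynomial_function_diff polynomial_mult polynomial_const polynomial_ridge)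
    have lw: "laplacian w x = r\<^sup>2 * (2 * (n + 2 * real m + 2 * real j - 2)) * real j * ridge a m (j - 1) x
        + r\<^sup>2 * E * ridge a (m - 2) j x - D * ridge a m j x - E * ridge a (m - 2) (Suc j) x" for x
      unfolding w_def D_def E_def n_def
      by (simp add: laplacian_diff laplacian_cmult polynomial_mult polynomial_const polynomial_ridge laplacian_ridge)
         (simp add: algebra_simps)
    have "poisson_solvable r (laplacian w)"
      unfolding poisson_solvable_def
    proof (intro exI[of _ w] conjI allI impI pw refl)
      show "w x = 0" if "norm x = r" for x
        using that by (simp add: w_def ridge_def dot_square_norm)
    qed
    \<comment> \<open>This is the formula \<open>lw\<close> solved for \<open>ridge a m j\<close>;
      every summand is a multiple of a function already known to be solvable.\<close>
    then have "poisson_solvable r (\<lambda>x. (1 / D) * (((r\<^sup>2 * (2 * (n + 2 * real m + 2 * real j - 2))) * real j * ridge a m (j - 1) x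
        + (r\<^sup>2 * (a \<bullet> a)) * (real m * (real m - 1)) * ridge a (m - 2) j x)
        + ((- (a \<bullet> a)) * (real m * (real m - 1)) * ridge a (m - 2) (Suc j) x + (- 1) * laplacian w x)))"
      by (intro poisson_solvable_cmult poisson_solvable_add low_m low_j)
    also have "(\<lambda>x. (1 / D) * (((r\<^sup>2 * (2 * (n + 2 * real m + 2 * real j - 2))) * real j * ridge a m (j - 1) x
        + (r\<^sup>2 * (a \<bullet> a)) * (real m * (real m - 1)) * ridge a (m - 2) j x)
        + ((- (a \<bullet> a)) * (real m * (real m - 1)) * ridge a (m - 2) (Suc j) x + (- 1) * laplacian w x))) = ridge a m j"
    proof
      fix x
      have "((r\<^sup>2 * (2 * (n + 2 * real m + 2 * real j - 2))) * real j * ridge a m (j - 1) x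
        + (r\<^sup>2 * (a \<bullet> a)) * (real m * (real m - 1)) * ridge a (m - 2) j x)
        + ((- (a \<bullet> a)) * (real m * (real m - 1)) * ridge a (m - 2) (Suc j) x + (- 1) * laplacian w x)
        = D * ridge a m j x"
        unfolding lw E_def by (simp add: algebra_simps)
      then show "(1 / D) * (((r\<^sup>2 * (2 * (n + 2 * real m + 2 * real j - 2))) * real j * ridge a m (j - 1) x
        + (r\<^sup>2 * (a \<bullet> a)) * (real m * (real m - 1)) * ridge a (m - 2) j x)
        + ((- (a \<bullet> a)) * (real m * (real m - 1)) * ridge a (m - 2) (Suc j) x + (- 1) * laplacian w x)) = ridge a m j x"
        using D by simp
    qed
    finally show ?thesis .
  qed
  show ?case
  proof (induction j)
    case 0
    show ?case
      by (rule step) (auto simp: poisson_solvable_def intro!: exI[of _ "\<lambda>x. 0"] polynomial_const)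
  next
    case (Suc j)
    then show ?case by (intro step) (simp add: poisson_solvable_cmult)
  qed
qed

text \<open>Boundary values are matched only up to \<delta>, because the harmonic extension of
  continuous data is in general not a polynomial.\<close>

definition harmonically_approximable :: "real \<Rightarrow> (real^'n \<Rightarrow> real) \<Rightarrow> bool" where
  "harmonically_approximable r f \<longleftrightarrow> (\<forall>\<delta>>0. \<exists>h. real_polynomial_function h \<and> (\<forall>x. laplacian h x = 0) \<and>
     (\<forall>x. norm x = r \<longrightarrow> \<bar>f x - h x\<bar> \<le> \<delta>))"

text \<open>Here the match is exact: subtracting a solution of a Poisson problem that vanishes on
  the sphere cancels the Laplacian and keeps the boundary values.\<close>

lemma harmonically_approximable_inner_power:
  fixes a :: "real^'n"
  shows "harmonically_approximable r (\<lambda>x. (a \<bullet> x) ^ m)"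
proof -
  obtain w where w: "real_polynomial_function w" "\<forall>x. norm x = r \<longrightarrow> w x = 0"
    "\<forall>x. laplacian w x = ridge a (m - 2) 0 x"
    using poisson_solvable_ridge[of r a "m - 2" 0] unfolding poisson_solvable_def by blast
  define h where "h = (\<lambda>x. (a \<bullet> x) ^ m - real m * (real m - 1) * (a \<bullet> a) * w x)"
  have p: "real_polynomial_function (\<lambda>x. (a \<bullet> x) ^ m)"
    by (intro real_polynomial_function_power polynomial_inner_left)
  have "real_polynomial_function h"
    unfolding h_def by (intro real_polynomial_function_diff polynomial_mult polynomial_const p w)
  moreover have "laplacian h x = 0" for x
    unfolding h_def using w
    by (simp add: laplacian_diff laplacian_cmult p polynomial_mult polynomial_const laplacian_inner_power ridge_def)
  moreover have "(a \<bullet> x) ^ m - h x = 0" if "norm x = r" for x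
    using w that by (simp add: h_def)
  ultimately show ?thesis unfolding harmonically_approximable_def by (metis abs_zero less_imp_le)
qed

lemma harmonically_approximable_add:
  assumes "harmonically_approximable r f" "harmonically_approximable r g"
  shows "harmonically_approximable r (\<lambda>x. f x + g x)"
  unfolding harmonically_approximable_def
proof (intro allI impI)
  fix \<delta> :: real assume "\<delta> > 0"
  then have "\<delta> / 2 > 0" by simp
  then obtain h h' where h: "real_polynomial_function h" "\<forall>x. laplacian h x = 0" "\<forall>x. norm x = r \<longrightarrow> \<bar>f x - h x\<bar> \<le> \<delta> / 2"
    and h': "real_polynomial_function h'" "\<forall>x. laplacian h' x = 0" "\<forall>x. norm x = r \<longrightarrow> \<bar>g x - h' x\<bar> \<le> \<delta> / 2"
    using assms unfolding harmonically_approximable_def by meson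
  have "\<bar>f x + g x - (h x + h' x)\<bar> \<le> \<delta>" if "norm x = r" for x
  proof -
    have "\<bar>f x - h x\<bar> \<le> \<delta> / 2" "\<bar>g x - h' x\<bar> \<le> \<delta> / 2" using h h' that by blast+
    then show ?thesis by linarith
  qed
  then show "\<exists>h. real_polynomial_function h \<and> (\<forall>x. laplacian h x = 0) \<and>
     (\<forall>x. norm x = r \<longrightarrow> \<bar>f x + g x - h x\<bar> \<le> \<delta>)"
    using h h' by (intro exI[of _ "\<lambda>x. h x + h' x"]) (simp add: laplacian_add polynomial_add)
qed

lemma harmonically_approximable_cmult:
  assumes "harmonically_approximable r f"
  shows "harmonically_approximable r (\<lambda>x. c * f x)"
  unfolding harmonically_approximable_def
proof (intro allI impI)
  fix \<delta> :: real assume \<delta>: "\<delta> > 0"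
  then have "\<delta> / (\<bar>c\<bar> + 1) > 0" by simp
  then obtain h where h: "real_polynomial_function h" "\<forall>x. laplacian h x = 0"
    "\<forall>x. norm x = r \<longrightarrow> \<bar>f x - h x\<bar> \<le> \<delta> / (\<bar>c\<bar> + 1)"
    using assms unfolding harmonically_approximable_def by meson
  have "\<bar>c * f x - c * h x\<bar> \<le> \<delta>" if "norm x = r" for x
  proof -
    have "\<bar>c * f x - c * h x\<bar> = \<bar>c\<bar> * \<bar>f x - h x\<bar>" by (simp flip: right_diff_distrib abs_mult)
    also have "\<dots> \<le> (\<bar>c\<bar> + 1) * (\<delta> / (\<bar>c\<bar> + 1))" using h(3) that by (intro mult_mono) auto
    finally show ?thesis by (simp add: add_nonneg_eq_0_iff)
  qed
  then show "\<exists>h. real_polynomial_function h \<and> (\<forall>x. laplacian h x = 0) \<and>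
     (\<forall>x. norm x = r \<longrightarrow> \<bar>c * f x - h x\<bar> \<le> \<delta>)"
    using h by (intro exI[of _ "\<lambda>x. c * h x"]) (simp add: laplacian_cmult polynomial_mult polynomial_const)
qed

lemma harmonically_approximable_sum:
  assumes "finite I" "\<And>i. i \<in> I \<Longrightarrow> harmonically_approximable r (f i)"
  shows "harmonically_approximable r (\<lambda>x. \<Sum>i\<in>I. f i x)"
  using assms
proof (induction rule: finite_induct)
  case empty
  have "\<exists>h. real_polynomial_function h \<and> (\<forall>x. laplacian h x = 0) \<and> (\<forall>x. norm x = r \<longrightarrow> \<bar>0 - h x\<bar> \<le> \<delta>)"
    if "\<delta> > 0" for \<delta>
    using that by (intro exI[of _ "\<lambda>x. 0"]) (simp add: polynomial_const)
  then show ?case unfolding harmonically_approximable_def by simp blast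
qed (simp add: harmonically_approximable_add)

lemma harmonically_approximable_limit:
  assumes "\<And>\<delta>. \<delta> > 0 \<Longrightarrow> \<exists>g. harmonically_approximable r g \<and> (\<forall>x. norm x = r \<longrightarrow> \<bar>f x - g x\<bar> \<le> \<delta>)"
  shows "harmonically_approximable r f"
  unfolding harmonically_approximable_def
proof (intro allI impI)
  fix \<delta> :: real assume "\<delta> > 0"
  then have \<delta>: "\<delta> / 2 > 0" by simp
  obtain g where g: "harmonically_approximable r g" "\<forall>x. norm x = r \<longrightarrow> \<bar>f x - g x\<bar> \<le> \<delta> / 2"
    using assms[OF \<delta>] by blast
  obtain h where h: "real_polynomial_function h" "\<forall>x. laplacian h x = 0" "\<forall>x. norm x = r \<longrightarrow> \<bar>g x - h x\<bar> \<le> \<delta> / 2"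
    using g(1) \<delta> unfolding harmonically_approximable_def by meson
  have "\<bar>f x - h x\<bar> \<le> \<delta>" if "norm x = r" for x
  proof -
    have "\<bar>f x - g x\<bar> \<le> \<delta> / 2" "\<bar>g x - h x\<bar> \<le> \<delta> / 2" using g h that by blast+
    then show ?thesis by linarith
  qed
  with h show "\<exists>h. real_polynomial_function h \<and> (\<forall>x. laplacian h x = 0) \<and>
     (\<forall>x. norm x = r \<longrightarrow> \<bar>f x - h x\<bar> \<le> \<delta>)" by blast
qed

text \<open>Exponentials are used because, unlike powers of single linear forms, they are closed
  under products. Their Taylor polynomials are sums of such powers and converge uniformly on the
  sphere.\<close>

lemma harmonically_approximable_exp:
  fixes a :: "real^'n"
  shows "harmonically_approximable r (\<lambda>x. exp (a \<bullet> x))"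
proof (rule harmonically_approximable_limit)
  fix \<delta> :: real assume \<delta>: "\<delta> > 0"
  define T where "T = norm a * \<bar>r\<bar>"
  have "(\<lambda>N. inverse (fact N) * T ^ N) \<longlonglongrightarrow> 0" by (rule summable_LIMSEQ_zero[OF summable_exp])
  then have "(\<lambda>N. exp T * (inverse (fact N) * T ^ N)) \<longlonglongrightarrow> exp T * 0" by (intro tendsto_intros)
  then have "\<forall>\<^sub>F N in sequentially. exp T * (inverse (fact N) * T ^ N) < \<delta>"
    using \<delta> by (intro order_tendstoD) auto
  then obtain N where N: "exp T * (inverse (fact N) * T ^ N) < \<delta>" by (auto simp: eventually_sequentially)
  let ?g = "\<lambda>x. \<Sum>m<N. (1 / fact m) * (a \<bullet> x) ^ m"
  have "harmonically_approximable r ?g"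
    by (intro harmonically_approximable_sum harmonically_approximable_cmult harmonically_approximable_inner_power) auto
  moreover have "\<bar>exp (a \<bullet> x) - ?g x\<bar> \<le> \<delta>" if "norm x = r" for x
  proof -
    have T: "\<bar>a \<bullet> x\<bar> \<le> T" unfolding T_def using Cauchy_Schwarz_ineq2[of a x] that by auto
    obtain t where t: "\<bar>t\<bar> \<le> \<bar>a \<bullet> x\<bar>" "exp (a \<bullet> x) = (\<Sum>m<N. (a \<bullet> x) ^ m / fact m) + (exp t / fact N) * (a \<bullet> x) ^ N"
      using Maclaurin_exp_le by blast
    have "\<bar>exp (a \<bullet> x) - ?g x\<bar> = exp t * (inverse (fact N) * \<bar>a \<bullet> x\<bar> ^ N)"
      by (simp add: t(2) abs_mult power_abs divide_inverse algebra_simps)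
    also have "\<dots> \<le> exp T * (inverse (fact N) * T ^ N)"
      using t T by (intro mult_mono power_mono) auto
    finally show ?thesis using N by simp
  qed
  ultimately show "\<exists>g. harmonically_approximable r g \<and> (\<forall>x. norm x = r \<longrightarrow> \<bar>exp (a \<bullet> x) - g x\<bar> \<le> \<delta>)"
    by (intro exI[of _ ?g] conjI allI impI)
qed

inductive exp_combination :: "(real^'n \<Rightarrow> real) \<Rightarrow> bool" where
  exp: "exp_combination (\<lambda>x. c * exp (a \<bullet> x))"
| add: "exp_combination f \<Longrightarrow> exp_combination g \<Longrightarrow> exp_combination (\<lambda>x. f x + g x)"

lemma exp_combination_mult:
  assumes "exp_combination f" "exp_combination g"
  shows "exp_combination (\<lambda>x. f x * g x)"
  using assms(1)
proof induction
  case (exp c a)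
  show ?case using assms(2)
  proof induction
    case (exp d b)
    have "(\<lambda>x. c * exp (a \<bullet> x) * (d * exp (b \<bullet> x))) = (\<lambda>x. (c * d) * exp ((a + b) \<bullet> x))"
      by (simp add: inner_add_left exp_add algebra_simps)
    then show ?case by (simp only: exp_combination.exp)
  next
    case (add f g)
    then show ?case by (simp add: distrib_left exp_combination.add)
  qed
next
  case (add f g)
  then show ?case by (simp add: distrib_right exp_combination.add)
qed

text \<open>Exponentials of linear forms span an algebra, so Stone-Weierstrass applies to their span.\<close>

lemma harmonically_approximable_continuous:
  fixes f :: "real^'n \<Rightarrow> real"
  assumes f: "continuous_on (sphere 0 r) f"
  shows "harmonically_approximable r f"
proof -
  interpret function_ring_on "Collect (exp_combination :: (real^'n \<Rightarrow> real) \<Rightarrow> bool)" "sphere 0 r"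
  proof
    fix f :: "real^'n \<Rightarrow> real" assume "f \<in> Collect exp_combination"
    then have "exp_combination f" by simp
    then show "continuous_on (sphere 0 r) f"
      by induction (auto intro!: continuous_intros)
  next
    fix c :: real
    show "(\<lambda>_::real^'n. c) \<in> Collect exp_combination"
      using exp_combination.exp[of c "0::real^'n"] by simp
  next
    fix x y :: "real^'n" assume "x \<noteq> y"
    then have "(x - y) \<bullet> x \<noteq> (x - y) \<bullet> y"
      by (metis inner_diff_right inner_eq_zero_iff right_minus_eq)
    then have "(\<lambda>z. 1 * exp ((x - y) \<bullet> z)) x \<noteq> (\<lambda>z. 1 * exp ((x - y) \<bullet> z)) y" by simp
    moreover have "(\<lambda>z. 1 * exp ((x - y) \<bullet> z)) \<in> Collect exp_combination"
      by (simp only: mem_Collect_eq exp_combination.exp)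
    ultimately show "\<exists>f\<in>Collect exp_combination. f x \<noteq> f y" by (rule bexI)
  next
    fix f g :: "real^'n \<Rightarrow> real" assume "f \<in> Collect exp_combination" "g \<in> Collect exp_combination"
    then show "(\<lambda>x. f x + g x) \<in> Collect exp_combination" "(\<lambda>x. f x * g x) \<in> Collect exp_combination"
      using exp_combination.add[of f g] exp_combination_mult[of f g] by simp_all
  qed simp
  have "harmonically_approximable r g" if "exp_combination g" for g
    using that
    by induction (auto intro: harmonically_approximable_cmult harmonically_approximable_exp harmonically_approximable_add)
  moreover have "\<exists>g. exp_combination g \<and> (\<forall>x. norm x = r \<longrightarrow> \<bar>f x - g x\<bar> \<le> \<delta>)" if \<delta>: "\<delta> > 0" for \<delta>
  proof -
    obtain g where "exp_combination g" "\<forall>x\<in>sphere 0 r. \<bar>f x - g x\<bar> < \<delta>"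
      using Stone_Weierstrass_basic[OF f \<delta>] by blast
    then show ?thesis by (intro exI[of _ g]) (auto simp: less_imp_le)
  qed
  ultimately show ?thesis
    using harmonically_approximable_limit[of r f] by blast
qed

text \<open>Both \<open>v\<close> and \<open>-v\<close> are compared with the harmonic polynomial of
  the boundary data plus a paraboloid whose Laplacian is slightly below
  \<open>- \<eta>\<close>.\<close>

lemma visc_harmonic_approximation:
  fixes v :: "real^'n \<Rightarrow> real"
  assumes v: "continuous_on (cball 0 r) v" "visc_sub r \<eta> v" "visc_sub r \<eta> (\<lambda>x. - v x)"
    and \<eta>: "\<eta> \<ge> 0" and r: "r > 0" and \<delta>: "\<delta> > 0"
  obtains h where "real_polynomial_function h" "\<And>x. laplacian h x = 0"
    "\<And>x. norm x \<le> r \<Longrightarrow> \<bar>v x - h x\<bar> \<le> \<eta> * r\<^sup>2 + \<delta>"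
proof -
  have "continuous_on (sphere 0 r) v" by (rule continuous_on_subset[OF v(1)]) auto
  then have "harmonically_approximable r v" by (rule harmonically_approximable_continuous)
  then obtain h where h: "real_polynomial_function h" "\<forall>x. laplacian h x = 0"
     "\<forall>x. norm x = r \<longrightarrow> \<bar>v x - h x\<bar> \<le> \<delta> / 2"
    using \<delta> half_gt_zero unfolding harmonically_approximable_def by blast
  define n where "n = real CARD('n)"
  \<comment> \<open>Chosen so that \<open>2 * n * k\<close> exceeds \<open>\<eta>\<close> by
    \<open>\<delta> / (2 * r\<^sup>2)\<close>: the excess gives strictness and raises the barrier by
    at most \<open>\<delta> / 2\<close>; the other \<open>\<delta> / 2\<close> is the boundary
    error.\<close>
  define k where "k = (\<eta> + \<delta> / (2 * r\<^sup>2)) / (2 * n)"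
  have n: "n \<ge> 1" by (simp add: n_def Suc_le_eq)
  have \<eta>': "\<eta> + \<delta> / (2 * r\<^sup>2) > \<eta>" using \<delta> r by simp
  have k: "k \<ge> 0" "2 * n * k > \<eta>" "k * r\<^sup>2 \<le> \<eta> * r\<^sup>2 + \<delta> / 2"
  proof -
    show "k \<ge> 0" using \<eta> \<eta>' n by (simp add: k_def)
    show "2 * n * k > \<eta>" using n \<eta>' by (simp add: k_def)
    have "k \<le> \<eta> + \<delta> / (2 * r\<^sup>2)"
      unfolding k_def using n \<eta> \<eta>' by (simp add: divide_le_eq mult_le_cancel_left1)
    then have "k * r\<^sup>2 \<le> (\<eta> + \<delta> / (2 * r\<^sup>2)) * r\<^sup>2" by (intro mult_right_mono) auto
    also have "\<dots> = \<eta> * r\<^sup>2 + \<delta> / 2" using r by (simp add: field_simps)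
    finally show "k * r\<^sup>2 \<le> \<eta> * r\<^sup>2 + \<delta> / 2" .
  qed
  have *: "s x \<le> q x + (\<eta> * r\<^sup>2 + \<delta>)"
    if s: "continuous_on (cball 0 r) s" "visc_sub r \<eta> s" 
      and q: "real_polynomial_function q" "\<And>x. laplacian q x = 0" "\<And>x. norm x = r \<Longrightarrow> s x \<le> q x + \<delta> / 2"
      and x: "norm x \<le> r" for s q :: "real^'n \<Rightarrow> real" and x
  proof -
    have "s x \<le> q x + (\<delta> / 2 + k * (r\<^sup>2 - x \<bullet> x))"
    proof (rule visc_sub_le_polynomial[OF s(2,1) _ _ _ x])
      show "real_polynomial_function (\<lambda>x. q x + (\<delta> / 2 + k * (r\<^sup>2 - x \<bullet> x)))"
        by (intro polynomial_add q polynomial_quadratic_barrier)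
      show "laplacian (\<lambda>x. q x + (\<delta> / 2 + k * (r\<^sup>2 - x \<bullet> x))) x < - \<eta>" for x
        using k q by (simp only: laplacian_add[OF q(1) polynomial_quadratic_barrier] laplacian_quadratic_barrier) (simp add: n_def)
    qed (use q(3) in \<open>auto simp: dot_square_norm algebra_simps\<close>)
    also have "k * (r\<^sup>2 - x \<bullet> x) \<le> k * r\<^sup>2" using k by (intro mult_left_mono) auto
    finally show ?thesis using k(3) by simp
  qed
  have "\<bar>v x - h x\<bar> \<le> \<eta> * r\<^sup>2 + \<delta>" if x: "norm x \<le> r" for x
  proof -
    have b: "\<bar>v y - h y\<bar> \<le> \<delta> / 2" if "norm y = r" for y using h that by blast
    have "v x \<le> h x + (\<eta> * r\<^sup>2 + \<delta>)"
    proof (rule *[OF v(1,2) h(1) _ _ x])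
      show "v y \<le> h y + \<delta> / 2" if "norm y = r" for y using b[OF that] by linarith
    qed (use h in simp)
    moreover have "- v x \<le> - h x + (\<eta> * r\<^sup>2 + \<delta>)"
    proof (rule *[OF _ v(3) _ _ _ x])
      show "laplacian (\<lambda>x. - h x) y = 0" for y
        using laplacian_cmult[OF h(1), of "-1" y] h by simp
      show "- v y \<le> - h y + \<delta> / 2" if "norm y = r" for y using b[OF that] by linarith
    qed (use v h in \<open>auto intro: continuous_intros\<close>)
    ultimately show ?thesis by linarith
  qed
  with that h show thesis by blast
qed

subsection \<open>Growth at a point where the second order expansion vanishes\<close>

text \<open>The viscosity form of a bound \<open>\<eta>\<close> on the absolute value of the
  Laplacian; the supersolution half is expressed through \<open>-v\<close>.\<close>

definition visc_bounded :: "real \<Rightarrow> real \<Rightarrow> (real^'n \<Rightarrow> real) \<Rightarrow> bool" where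
  "visc_bounded r \<eta> v \<longleftrightarrow> visc_sub r \<eta> v \<and> visc_sub r \<eta> (\<lambda>x. - v x)"

lemma polynomial_dderiv_iter:
  "real_polynomial_function f \<Longrightarrow> real_polynomial_function ((dderiv e ^^ i) f)"
  by (induction i) (auto intro: polynomial_dderiv)

lemma dderiv_iter_diff:
  assumes "real_polynomial_function f" "real_polynomial_function g"
  shows "(dderiv e ^^ i) (\<lambda>x. f x - g x) = (\<lambda>x. (dderiv e ^^ i) f x - (dderiv e ^^ i) g x)"
  by (induction i) (simp_all add: dderiv_diff polynomial_dderiv_iter assms)

lemma laplacian_dderiv_iter:
  fixes f :: "real^'n \<Rightarrow> real"
  assumes "real_polynomial_function f" "\<And>x. laplacian f x = 0"
  shows "laplacian ((dderiv e ^^ i) f) x = 0"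
proof (induction i arbitrary: x)
  case (Suc i)
  then have "laplacian ((dderiv e ^^ i) f) = (\<lambda>x. 0)" by auto
  then show ?case by (simp add: laplacian_dderiv polynomial_dderiv_iter assms)
qed (simp add: assms)

text \<open>The gradient estimate is iterated on balls of halved radius. The losses 1, 2, 4, ...
  from the shrinking radii multiply to at most \<open>2 ^ i ^ 2\<close>.\<close>

lemma harmonic_dderiv_iter_bound_aux:
  fixes w :: "real^'n \<Rightarrow> real"
  assumes w: "real_polynomial_function w" "\<And>x. laplacian w x = 0" and r: "r > 0"
    and bd: "\<And>x. norm x \<le> r \<Longrightarrow> \<bar>w x\<bar> \<le> S" and x: "norm x \<le> r / 2 ^ i"
  shows "\<bar>(dderiv e ^^ i) w x\<bar> \<le> Bernstein_const TYPE('n) ^ i * 2 ^ i ^ 2 * S * (norm e / r) ^ i"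
  using x
proof (induction i arbitrary: x)
  case (Suc i)
  let ?K = "Bernstein_const TYPE('n)"
  have K: "?K \<ge> 0" by (simp add: Bernstein_const_def)
  have S: "S \<ge> 0" using bd[of 0] r by (smt (verit) norm_zero)
  let ?B = "?K ^ i * 2 ^ i ^ 2 * S * (norm e / r) ^ i"
  have "\<bar>dderiv e ((dderiv e ^^ i) w) x\<bar> \<le> ?K * ?B * (norm e / (r / 2 ^ i))"
    by (rule harmonic_dderiv_bound)
       (use Suc r in \<open>auto intro: polynomial_dderiv_iter laplacian_dderiv_iter w simp: mult.commute\<close>)
  also have "\<dots> = ?K ^ Suc i * (2 ^ i ^ 2 * 2 ^ i) * S * (norm e / r) ^ Suc i"
    by (simp add: field_simps)
  also have "\<dots> \<le> ?K ^ Suc i * 2 ^ Suc i ^ 2 * S * (norm e / r) ^ Suc i"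
  proof -
    have "2 ^ i ^ 2 * 2 ^ i = (2::real) ^ (i ^ 2 + i)" by (simp add: power_add)
    also have "\<dots> \<le> 2 ^ Suc i ^ 2" by (intro power_increasing) (auto simp: power2_eq_square)
    finally show ?thesis using K S r by (intro mult_right_mono mult_left_mono) auto
  qed
  finally show ?case by simp
qed (use bd in auto)

text \<open>The constant of the preceding bound at order 3, with \<open>512 = 2 ^ 3 ^ 2\<close>; it
  serves all lower orders too.\<close>

definition interior_const :: "'n::finite itself \<Rightarrow> real" where
  "interior_const _ = 512 * Bernstein_const TYPE('n) ^ 3"

lemma interior_const_ge_1: "interior_const TYPE('n::finite) \<ge> 1"
proof -
  have "Bernstein_const TYPE('n) ^ 3 \<ge> 1" by (intro one_le_power) (simp add: Bernstein_const_def)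
  then show ?thesis by (simp add: interior_const_def)
qed

lemma harmonic_dderiv_iter_bound:
  fixes w :: "real^'n \<Rightarrow> real"
  assumes w: "real_polynomial_function w" "\<And>x. laplacian w x = 0" and r: "r > 0"
    and bd: "\<And>x. norm x \<le> r \<Longrightarrow> \<bar>w x\<bar> \<le> S" and x: "norm x \<le> r / 8" and i: "i \<le> 3"
  shows "\<bar>(dderiv e ^^ i) w x\<bar> \<le> interior_const TYPE('n) * S * (norm e / r) ^ i"
proof -
  let ?K = "Bernstein_const TYPE('n)"
  have K: "?K \<ge> 1" by (simp add: Bernstein_const_def)
  have S: "S \<ge> 0" using bd[of 0] r by (smt (verit) norm_zero)
  have "(2::real) ^ i \<le> 2 ^ 3" using i by (intro power_increasing) auto
  then have "r / 8 \<le> r / 2 ^ i" using r by (intro divide_left_mono) auto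
  then have "\<bar>(dderiv e ^^ i) w x\<bar> \<le> ?K ^ i * 2 ^ i ^ 2 * S * (norm e / r) ^ i"
    using x by (intro harmonic_dderiv_iter_bound_aux w r bd order_trans[OF x])
  also have "\<dots> \<le> (?K ^ 3 * 2 ^ 3 ^ 2) * S * (norm e / r) ^ i"
    using K S r i by (intro mult_right_mono mult_mono power_increasing power_mono) auto
  finally show ?thesis by (simp add: interior_const_def mult.commute)
qed

text \<open>Maclaurin's formula on the segment from 0 to \<open>x\<close>, with derivatives in the
  direction \<open>x\<close> itself and the factorials dropped.\<close>

lemma polynomial_Taylor_bound:
  fixes f :: "real^'n \<Rightarrow> real"
  assumes f: "real_polynomial_function f"
  obtains y where "norm y \<le> norm x"
    "\<bar>f x\<bar> \<le> \<bar>f 0\<bar> + \<bar>(dderiv x ^^ 1) f 0\<bar> + \<bar>(dderiv x ^^ 2) f 0\<bar> + \<bar>(dderiv x ^^ 3) f y\<bar>"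
proof -
  define d where "d i t = (dderiv x ^^ i) f (0 + t *\<^sub>R x)" for i t
  have "\<forall>m t. (d m has_real_derivative d (Suc m) t) (at t)"
    unfolding d_def using dderiv_line[OF polynomial_dderiv_iter[OF f], where a=0 and e=x] by simp
  then obtain t where t: "\<bar>t\<bar> \<le> \<bar>1::real\<bar>" "d 0 1 = (\<Sum>m<3. (d m 0 / fact m) * 1 ^ m) + (d 3 t / fact 3) * 1 ^ 3"
    using Maclaurin_all_le[of d "d 0" 1 3] by blast
  have "f x = d 0 0 + d 1 0 + d 2 0 / 2 + d 3 t / 6"
    using t(2) by (simp add: d_def numeral_3_eq_3 eval_nat_numeral)
  moreover have "d i 0 = (dderiv x ^^ i) f 0" for i by (simp add: d_def)
  moreover have "d 3 t = (dderiv x ^^ 3) f (t *\<^sub>R x)" by (simp add: d_def)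
  ultimately have "f x = f 0 + (dderiv x ^^ 1) f 0 + (dderiv x ^^ 2) f 0 / 2 + (dderiv x ^^ 3) f (t *\<^sub>R x) / 6"
    by (metis funpow_0)
  moreover have "norm (t *\<^sub>R x) \<le> norm x" using t(1) by (simp add: mult_left_le_one_le)
  ultimately show thesis by (intro that[of "t *\<^sub>R x"]) linarith+
qed

lemma telescope_abs:
  fixes a :: "nat \<Rightarrow> real"
  assumes "k \<le> m"
  shows "\<bar>a m - a k\<bar> \<le> (\<Sum>j=k..<m. \<bar>a (Suc j) - a j\<bar>)"
  using sum_abs[of "\<lambda>j. a (Suc j) - a j" "{k..<m}"] by (simp add: sum_Suc_diff' assms)

text \<open>Compare \<open>v\<close> on dyadic balls with harmonic polynomials \<open>h\<^sub>k\<close>. The third derivatives of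
  \<open>h\<^sub>k\<close> are summed from the coarsest scale down to scale \<open>k\<close>; its second order Taylor polynomial
  at \<open>0\<close> is summed from scale \<open>k\<close> down to a scale \<open>m\<close>, where it is small.\<close>

lemma dyadic_growth:
  fixes v :: "real^'n \<Rightarrow> real" and \<eta> :: "nat \<Rightarrow> real"
  defines "r \<equiv> \<lambda>k::nat. (1 / 2 :: real) ^ k"
  assumes v: "continuous_on (ball 0 1) v" "\<And>x. norm x < 1 \<Longrightarrow> \<bar>v x\<bar> \<le> 1"
    and vb: "\<And>k. 1 \<le> k \<Longrightarrow> visc_bounded (r k) (\<eta> k) v"
    and \<eta>: "\<And>k. \<eta> k > 0" "\<And>k. \<eta> (Suc k) \<le> \<eta> k"
    and km: "1 \<le> k" "k \<le> m"
    and small: "\<And>x. norm x \<le> r m \<Longrightarrow> \<bar>v x\<bar> \<le> \<epsilon> * (r m)\<^sup>2"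
    and x: "norm x \<le> r (k + 3)"
  shows "\<bar>v x\<bar> \<le> 50 * interior_const TYPE('n) * (r k)\<^sup>2 *
    (r k * (1 + (\<Sum>j=1..k. \<eta> j / r j)) + (\<Sum>j=k..m. \<eta> j) + \<epsilon>)"
proof -
  define C where "C = interior_const TYPE('n)"
  have C: "C \<ge> 1" unfolding C_def by (rule interior_const_ge_1)
  have rpos: "r j > 0" for j by (simp add: r_def)
  have rne: "r j \<noteq> 0" for j using rpos[of j] by simp
  have rS: "r (Suc j) = r j / 2" for j by (simp add: r_def)
  have rmono: "i \<le> j \<Longrightarrow> r j \<le> r i" for i j by (simp add: r_def power_decreasing)
  have r3: "r (j + 3) = r j / 8" for j by (simp add: r_def power_add eval_nat_numeral)
  have r1: "1 \<le> j \<Longrightarrow> r j < 1" for j by (simp add: r_def power_less_one_iff)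
  \<comment> \<open>The boundary error is allowed to be as large as the error
    \<open>\<eta> j * (r j)\<^sup>2\<close> from the right-hand side; hence the factor 2.\<close>
  have "\<exists>h. real_polynomial_function h \<and> (\<forall>x. laplacian h x = 0) \<and>
     (\<forall>x. norm x \<le> r j \<longrightarrow> \<bar>v x - h x\<bar> \<le> 2 * \<eta> j * (r j)\<^sup>2)" if j: "1 \<le> j" for j
  proof -
    have "continuous_on (cball 0 (r j)) v"
      by (rule continuous_on_subset[OF v(1)]) (use r1[OF j] in auto)
    then obtain h where "real_polynomial_function h" "\<And>x. laplacian h x = 0"
        "\<And>x. norm x \<le> r j \<Longrightarrow> \<bar>v x - h x\<bar> \<le> \<eta> j * (r j)\<^sup>2 + \<eta> j * (r j)\<^sup>2"
      using visc_harmonic_approximation[of "r j" v "\<eta> j" "\<eta> j * (r j)\<^sup>2"] vb[OF j] \<eta>(1)[of j] rpos[of j]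
      unfolding visc_bounded_def by (metis less_imp_le mult_pos_pos zero_less_power)
    then show ?thesis by (intro exI[of _ h]) (simp add: algebra_simps)
  qed
  then obtain h where h: "\<And>j. 1 \<le> j \<Longrightarrow> real_polynomial_function (h j)" "\<And>j x. 1 \<le> j \<Longrightarrow> laplacian (h j) x = 0"
    "\<And>j x. 1 \<le> j \<Longrightarrow> norm x \<le> r j \<Longrightarrow> \<bar>v x - h j x\<bar> \<le> 2 * \<eta> j * (r j)\<^sup>2"
    by metis
  define S1 where "S1 = (\<Sum>j=1..k. \<eta> j / r j)"
  define S2 where "S2 = (\<Sum>j=k..m. \<eta> j)"
  have ratio_nonneg: "\<eta> j / r j \<ge> 0" for j using \<eta>(1)[of j] rpos[of j] by simp
  have \<eta>_nonneg: "\<eta> j \<ge> 0" for j using \<eta>(1)[of j] by simp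
  have S1: "\<eta> 1 / r 1 \<le> S1" "(\<Sum>j=1..<k. \<eta> j / r j) \<le> S1"
  proof -
    show "\<eta> 1 / r 1 \<le> S1" unfolding S1_def
      by (rule member_le_sum) (use km ratio_nonneg in auto)
    show "(\<Sum>j=1..<k. \<eta> j / r j) \<le> S1" unfolding S1_def
      by (rule sum_mono2) (use ratio_nonneg in auto)
  qed
  have S2: "S2 = (\<Sum>j=k..<m. \<eta> j) + \<eta> m" "\<eta> k \<le> S2"
  proof -
    show "S2 = (\<Sum>j=k..<m. \<eta> j) + \<eta> m" unfolding S2_def using km
      by (metis add.commute sum.last_plus)
    show "\<eta> k \<le> S2" unfolding S2_def by (rule member_le_sum) (use km \<eta>_nonneg in auto)
  qed
  have \<epsilon>: "\<epsilon> \<ge> 0"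
  proof -
    have "0 \<le> \<epsilon> * (r m)\<^sup>2" using small[of 0] rpos[of m] by (smt (verit) norm_zero)
    then show ?thesis using rpos[of m] by (simp add: zero_le_mult_iff)
  qed
  have xk: "norm x \<le> r k" using x r3[of k] rpos[of k] by simp
  let ?D = "\<lambda>i. dderiv x ^^ i"
  \<comment> \<open>Since \<open>norm x\<close> is at most \<open>r k\<close>, each derivative in
    direction \<open>x\<close> on the ball of radius \<open>r (Suc j)\<close> costs a factor
    \<open>r k / r (Suc j) = 2 * r k / r j\<close>. The range of \<open>y\<close> is that radius
    divided by 8, as the interior estimate demands.\<close>
  have D: "\<bar>?D i (h (Suc j)) y - ?D i (h j) y\<bar> \<le> 4 * C * \<eta> j * (r j)\<^sup>2 * (2 * r k / r j) ^ i"
    if j: "1 \<le> j" and y: "norm y \<le> r (j + 4)" and i: "i \<le> 3" for i j y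
  proof -
    have "\<bar>h (Suc j) z - h j z\<bar> \<le> 4 * \<eta> j * (r j)\<^sup>2" if z: "norm z \<le> r (Suc j)" for z
    proof -
      have "\<bar>v z - h (Suc j) z\<bar> \<le> 2 * \<eta> (Suc j) * (r (Suc j))\<^sup>2" using h(3)[of "Suc j"] z by simp
      also have "\<dots> \<le> 2 * \<eta> j * (r j)\<^sup>2"
        using \<eta> rpos \<eta>_nonneg rmono[of j "Suc j"] by (intro mult_mono power_mono) (auto simp: less_imp_le)
      finally have 1: "\<bar>v z - h (Suc j) z\<bar> \<le> 2 * \<eta> j * (r j)\<^sup>2" .
      have "norm z \<le> r j" using z rmono[of j "Suc j"] by simp
      then show ?thesis using 1 h(3)[OF j, of z] by linarith
    qed
    then have "\<bar>(?D i) (\<lambda>z. h (Suc j) z - h j z) y\<bar> \<le> C * (4 * \<eta> j * (r j)\<^sup>2) * (norm x / r (Suc j)) ^ i"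
      unfolding C_def
      by (intro harmonic_dderiv_iter_bound)
         (use j y i h rpos r3[of "Suc j"] in \<open>auto simp: laplacian_diff numeral_eq_Suc intro: real_polynomial_function_diff\<close>)
    also have "\<dots> \<le> C * (4 * \<eta> j * (r j)\<^sup>2) * (2 * r k / r j) ^ i"
      using C \<eta>_nonneg rpos xk by (intro mult_left_mono power_mono) (auto simp: rS less_imp_le intro!: divide_right_mono)
    finally show ?thesis using h j by (simp add: dderiv_iter_diff algebra_simps)
  qed
  \<comment> \<open>Each difference contributes a multiple of \<open>\<eta> j / r j\<close>,
    weighted towards fine scales, so the sum starts at scale 1, where \<open>v\<close> is at most 1.
    The constant is 8 from \<open>r 1 = 1 / 2\<close> plus 32 from the differences.\<close>
  have third: "\<bar>?D 3 (h k) y\<bar> \<le> 40 * C * (r k) ^ 3 * (1 + S1)" if y: "norm y \<le> r (k + 3)" for y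
  proof -
    have "\<bar>h 1 z\<bar> \<le> 1 + S1" if z: "norm z \<le> r 1" for z
    proof -
      have "\<bar>v z - h 1 z\<bar> \<le> 2 * \<eta> 1 * (r 1)\<^sup>2" using h(3) z by simp
      also have "\<dots> \<le> \<eta> 1 / r 1" using \<eta>_nonneg[of 1] by (simp add: r_def power2_eq_square)
      finally show ?thesis using v(2)[of z] z r1[of 1] S1(1) by fastforce
    qed
    then have "\<bar>?D 3 (h 1) y\<bar> \<le> C * (1 + S1) * (norm x / r 1) ^ 3"
      unfolding C_def
      by (intro harmonic_dderiv_iter_bound)
         (use y h rpos rmono[of 4 "k + 3"] km r3[of 1] in auto)
    also have "\<dots> \<le> C * (1 + S1) * (r k / r 1) ^ 3"
      using C S1 ratio_nonneg[of 1] rpos xk by (intro mult_left_mono power_mono divide_right_mono) (auto simp: less_imp_le)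
    also have "\<dots> = 8 * C * (r k) ^ 3 * (1 + S1)" by (simp add: r_def[of] power_divide)
    finally have 1: "\<bar>?D 3 (h 1) y\<bar> \<le> 8 * C * (r k) ^ 3 * (1 + S1)" .
    have "\<bar>?D 3 (h k) y - ?D 3 (h 1) y\<bar> \<le> (\<Sum>j=1..<k. \<bar>?D 3 (h (Suc j)) y - ?D 3 (h j) y\<bar>)"
      using telescope_abs[of 1 k "\<lambda>j. ?D 3 (h j) y"] km by simp
    also have "\<dots> \<le> (\<Sum>j=1..<k. 4 * C * \<eta> j * (r j)\<^sup>2 * (2 * r k / r j) ^ 3)"
    proof (intro sum_mono D)
      fix j assume "j \<in> {1..<k}"
      then show "norm y \<le> r (j + 4)" using y rmono[of "j + 4" "k + 3"] by simp
    qed auto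
    also have "\<dots> = (\<Sum>j=1..<k. 32 * C * (r k) ^ 3 * (\<eta> j / r j))"
      using rne by (intro sum.cong) (auto simp: field_simps power2_eq_square power3_eq_cube)
    also have "\<dots> \<le> 32 * C * (r k) ^ 3 * S1"
      unfolding sum_distrib_left[symmetric] using S1 C rpos[of k] by (intro mult_left_mono) auto
    also have "\<dots> \<le> 32 * C * (r k) ^ 3 * (1 + S1)"
      using C rpos[of k] by (intro mult_left_mono) auto
    finally show ?thesis using 1 by linarith
  qed
  \<comment> \<open>At scale \<open>m\<close>, derivatives of order at most 2 cost at most
    \<open>(r k / r m)\<^sup>2\<close>, which exactly cancels the factor
    \<open>(r m)\<^sup>2\<close> in \<open>small\<close>. Hence \<open>m\<close> can be arbitrarily
    large at no cost.\<close>
  have low: "\<bar>?D i (h k) 0\<bar> \<le> 16 * C * (r k)\<^sup>2 * (S2 + \<epsilon>)" if i: "i \<le> 2" for i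
  proof -
    have "\<bar>h m z\<bar> \<le> (\<epsilon> + 2 * \<eta> m) * (r m)\<^sup>2" if z: "norm z \<le> r m" for z
      using small[OF z] h(3)[of m z] z km by (simp add: algebra_simps)
    then have "\<bar>?D i (h m) 0\<bar> \<le> C * ((\<epsilon> + 2 * \<eta> m) * (r m)\<^sup>2) * (norm x / r m) ^ i"
      unfolding C_def
      by (intro harmonic_dderiv_iter_bound)
         (use h rpos i km in \<open>auto simp: less_imp_le\<close>)
    also have "\<dots> \<le> C * ((\<epsilon> + 2 * \<eta> m) * (r m)\<^sup>2) * (r k / r m) ^ i"
      using C \<epsilon> \<eta>_nonneg rpos xk by (intro mult_left_mono power_mono divide_right_mono) (auto simp: less_imp_le)
    also have "\<dots> \<le> C * ((\<epsilon> + 2 * \<eta> m) * (r m)\<^sup>2) * (r k / r m) ^ 2"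
      using C \<epsilon> \<eta>_nonneg rpos rmono[OF km(2)] i by (intro mult_left_mono power_increasing) auto
    also have "\<dots> = C * (r k)\<^sup>2 * (\<epsilon> + 2 * \<eta> m)"
      using rpos[of m] by (simp add: field_simps)
    finally have 1: "\<bar>?D i (h m) 0\<bar> \<le> C * (r k)\<^sup>2 * (\<epsilon> + 2 * \<eta> m)" .
    have "\<bar>?D i (h m) 0 - ?D i (h k) 0\<bar> \<le> (\<Sum>j=k..<m. \<bar>?D i (h (Suc j)) 0 - ?D i (h j) 0\<bar>)"
      using telescope_abs[of k m "\<lambda>j. ?D i (h j) 0"] km by simp
    also have "\<dots> \<le> (\<Sum>j=k..<m. 4 * C * \<eta> j * (r j)\<^sup>2 * (2 * r k / r j) ^ i)"
      using i km rpos by (intro sum_mono D) (auto simp: less_imp_le)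
    also have "\<dots> \<le> (\<Sum>j=k..<m. 4 * C * \<eta> j * (r j)\<^sup>2 * (2 * r k / r j) ^ 2)"
    proof (intro sum_mono mult_left_mono power_increasing i)
      fix j assume "j \<in> {k..<m}"
      then show "1 \<le> 2 * r k / r j" using rmono[of k j] rpos[of j] by simp
    qed (use C \<eta>_nonneg in auto)
    also have "\<dots> = (\<Sum>j=k..<m. 16 * C * (r k)\<^sup>2 * \<eta> j)"
      using rne by (intro sum.cong) (auto simp: field_simps power2_eq_square)
    finally have 2: "\<bar>?D i (h m) 0 - ?D i (h k) 0\<bar> \<le> 16 * C * (r k)\<^sup>2 * (\<Sum>j=k..<m. \<eta> j)"
      by (simp add: sum_distrib_left)
    have "\<epsilon> + 2 * \<eta> m \<le> 16 * (\<epsilon> + \<eta> m)" using \<epsilon> \<eta>_nonneg[of m] by simp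
    then have "C * (r k)\<^sup>2 * (\<epsilon> + 2 * \<eta> m) \<le> C * (r k)\<^sup>2 * (16 * (\<epsilon> + \<eta> m))"
      using C by (intro mult_left_mono) auto
    then have "\<bar>?D i (h k) 0\<bar> \<le> C * (r k)\<^sup>2 * (16 * (\<epsilon> + \<eta> m)) + 16 * C * (r k)\<^sup>2 * (\<Sum>j=k..<m. \<eta> j)"
      using 1 2 by linarith
    also have "\<dots> = 16 * C * (r k)\<^sup>2 * (S2 + \<epsilon>)" by (simp add: S2 algebra_simps)
    finally show ?thesis .
  qed
  obtain y where y: "norm y \<le> norm x"
    "\<bar>h k x\<bar> \<le> \<bar>h k 0\<bar> + \<bar>(?D 1) (h k) 0\<bar> + \<bar>(?D 2) (h k) 0\<bar> + \<bar>(?D 3) (h k) y\<bar>"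
    using polynomial_Taylor_bound[OF h(1)[OF km(1)]] by blast
  have "\<bar>h k 0\<bar> \<le> 16 * C * (r k)\<^sup>2 * (S2 + \<epsilon>)" "\<bar>(?D 1) (h k) 0\<bar> \<le> 16 * C * (r k)\<^sup>2 * (S2 + \<epsilon>)"
      "\<bar>(?D 2) (h k) 0\<bar> \<le> 16 * C * (r k)\<^sup>2 * (S2 + \<epsilon>)"
    using low[of 0] low[of 1] low[of 2] by simp_all
  moreover have "\<bar>(?D 3) (h k) y\<bar> \<le> 40 * C * (r k) ^ 3 * (1 + S1)"
    using third y(1) x by simp
  moreover have "\<bar>v x - h k x\<bar> \<le> 2 * \<eta> k * (r k)\<^sup>2" using h(3)[OF km(1) xk] .
  \<comment> \<open>Three low order terms with constant 16 give 48; the approximation error adds the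
    2 that makes up 50.\<close>
  ultimately have "\<bar>v x\<bar> \<le> 48 * (C * (r k)\<^sup>2 * (S2 + \<epsilon>)) + 40 * (C * (r k)^3 * (1 + S1)) + 2 * (\<eta> k * (r k)\<^sup>2)"
    using y(2) by linarith
  also have "\<eta> k * (r k)\<^sup>2 \<le> C * (r k)\<^sup>2 * (S2 + \<epsilon>)"
  proof -
    have "\<eta> k * (r k)\<^sup>2 \<le> (S2 + \<epsilon>) * (r k)\<^sup>2" using S2(2) \<epsilon> by (intro mult_right_mono) auto
    also have "\<dots> = 1 * ((S2 + \<epsilon>) * (r k)\<^sup>2)" by simp
    also have "\<dots> \<le> C * ((S2 + \<epsilon>) * (r k)\<^sup>2)"
      using C S2(2) \<eta>_nonneg[of k] \<epsilon> by (intro mult_right_mono) auto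
    finally show ?thesis by (simp add: algebra_simps)
  qed
  also have "40 * (C * (r k)^3 * (1 + S1)) \<le> 50 * (C * (r k)^3 * (1 + S1))"
    using C rpos[of k] S1(1) ratio_nonneg[of 1] by simp
  finally show ?thesis
    unfolding C_def[symmetric] S1_def[symmetric] S2_def[symmetric]
    by (simp add: algebra_simps power2_eq_square power3_eq_cube)
qed

subsection \<open>Bootstrapping the growth exponent\<close>

text \<open>On each ball the nonlinear right-hand side is replaced by a constant bound, the only
  form in which the equation enters the growth estimate.\<close>

definition sublinear_visc :: "real \<Rightarrow> real \<Rightarrow> (real^'n \<Rightarrow> real) \<Rightarrow> bool" where
  "sublinear_visc \<Lambda> \<gamma> v \<longleftrightarrow> continuous_on (ball 0 1) v \<and>
     (\<forall>r \<eta>. 0 < r \<and> r < 1 \<and> (\<forall>x\<in>ball 0 r. \<Lambda> * \<bar>v x\<bar> powr \<gamma> \<le> \<eta>) \<longrightarrow> visc_bounded r \<eta> v)"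

definition vanishes_second_order :: "(real^'n \<Rightarrow> real) \<Rightarrow> bool" where
  "vanishes_second_order v \<longleftrightarrow> (\<forall>\<epsilon>>0. \<exists>\<delta>>0. \<forall>x. norm x < \<delta> \<longrightarrow> \<bar>v x\<bar> \<le> \<epsilon> * (norm x)\<^sup>2)"

text \<open>The factor involves the bound \<open>t\<close> on the ratio and not the ratio
  \<open>s\<close>, here as in the decreasing case below. This is what makes the bootstrap constant
  independent of the exponent q.\<close>

lemma sum_power_increasing_le:
  fixes s t :: real
  assumes "1 < t" "t \<le> s"
  shows "(\<Sum>j=1..k. s ^ j) \<le> t / (t - 1) * s ^ k"
proof (induction k)
  case (Suc k)
  have "s / (s - 1) \<le> t / (t - 1)" using assms by (simp add: field_simps)
  then have "s \<le> t / (t - 1) * (s - 1)" using assms by (simp add: pos_divide_le_eq)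
  then have "t / (t - 1) + s \<le> t / (t - 1) * s" by (simp add: right_diff_distrib)
  then have "(t / (t - 1) + s) * s ^ k \<le> t / (t - 1) * s * s ^ k"
    using assms by (intro mult_right_mono) auto
  with Suc show ?case by (simp add: algebra_simps)
qed (use assms in auto)

lemma sum_power_decreasing_le:
  fixes s t :: real
  assumes "0 < s" "s \<le> t" "t < 1"
  shows "(\<Sum>j=k..m. s ^ j) \<le> 1 / (1 - t) * s ^ k"
proof (cases "k \<le> m")
  case True
  then have "(\<Sum>j=k..m. s ^ j) = (s ^ k - s ^ Suc m) / (1 - s)"
    using assms by (subst sum_gp) auto
  also have "\<dots> \<le> s ^ k / (1 - s)" using assms by (intro divide_right_mono) auto
  also have "\<dots> \<le> s ^ k / (1 - t)" using assms by (intro divide_left_mono) auto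
  finally show ?thesis by simp
qed (use assms in auto)

text \<open>Of the four halvings in the factor 16, three are demanded by
  \<open>dyadic_growth\<close> and one comes from rounding to a power of 1/2.\<close>

lemma dyadic_bracket:
  fixes t :: real
  assumes "0 < t" "t \<le> 1 / 16"
  obtains k where "1 \<le> k" "t \<le> (1 / 2) ^ (k + 3)" "(1 / 2) ^ k \<le> 16 * t"
proof -
  define n where "n = (LEAST n. (1 / 2) ^ n < t)"
  have "\<exists>n. (1 / 2 :: real) ^ n < t" using real_arch_pow_inv[OF assms(1)] by simp
  then have n: "(1 / 2) ^ n < t" unfolding n_def by (rule LeastI_ex)
  have min: "t \<le> (1 / 2) ^ j" if "j < n" for j
    using not_less_Least[of j "\<lambda>n. (1 / 2) ^ n < t"] that by (simp add: n_def)
  have "n > 4"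
  proof (rule ccontr)
    assume "\<not> n > 4"
    then have "(1 / 2 :: real) ^ 4 \<le> (1 / 2) ^ n" by (intro power_decreasing) auto
    then show False using n assms(2) by (simp add: eval_nat_numeral)
  qed
  define k where "k = n - 4"
  have k: "n = k + 4" "1 \<le> k" using \<open>n > 4\<close> by (auto simp: k_def)
  show thesis
  proof (rule that[OF k(2)])
    show "t \<le> (1 / 2) ^ (k + 3)" using min[of "k + 3"] k by simp
    show "(1 / 2) ^ k \<le> 16 * t" using n by (simp add: k(1) power_add eval_nat_numeral)
  qed
qed

text \<open>\<open>204800 = 50 * 16 ^ 3\<close>: the factor of \<open>dyadic_growth\<close> and the
  loss in \<open>dyadic_bracket\<close>. The two quotients bound geometric sums of ratio
  \<open>2 * \<rho>\<close> and \<open>\<rho>\<close>, with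
  \<open>\<rho> = (1 / 2) powr (\<gamma> * q)\<close>, at their worst exponents:
  \<open>q = 2 / (1 - \<gamma>)\<close> for the first and \<open>q = 2\<close> for the
  second.\<close>

definition bootstrap_const :: "'n::finite itself \<Rightarrow> real \<Rightarrow> real \<Rightarrow> real" where
  "bootstrap_const N \<Lambda> \<gamma> = 204800 * interior_const N *
     (1 + \<Lambda> * (2 * (1 / 2) powr (2 * \<gamma> / (1 - \<gamma>)) / (2 * (1 / 2) powr (2 * \<gamma> / (1 - \<gamma>)) - 1)) +
      \<Lambda> * (1 / (1 - (1 / 2) powr (2 * \<gamma>))))"

lemma growth_exponent:
  fixes \<gamma> :: real
  assumes "0 < \<gamma>" "\<gamma> < 1 / 3"
  shows "2 < 2 / (1 - \<gamma>)" "2 / (1 - \<gamma>) < 3"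
    "2 + \<gamma> * (2 / (1 - \<gamma>)) = 2 / (1 - \<gamma>)"
  using assms by (simp_all add: field_simps)

text \<open>The first inequality, equivalent to \<open>\<gamma> < 1 / 3\<close> in this range, lets
  the last term dominate the third derivative sums; the second makes the sums of low order
  coefficients converge.\<close>

lemma bootstrap_ratio:
  assumes "0 < \<gamma>" "\<gamma> < 1 / (3::real)"
  shows "1 < 2 * (1 / 2 :: real) powr (2 * \<gamma> / (1 - \<gamma>))" "(1 / 2 :: real) powr (2 * \<gamma>) < 1"
proof -
  have "2 * \<gamma> / (1 - \<gamma>) < 1" using assms by (simp add: field_simps)
  then have "(1 / 2 :: real) powr 1 < (1 / 2) powr (2 * \<gamma> / (1 - \<gamma>))"
    by (intro powr_less_mono') auto
  then show "1 < 2 * (1 / 2 :: real) powr (2 * \<gamma> / (1 - \<gamma>))" by simp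
  have "(1 / 2 :: real) powr (2 * \<gamma>) < (1 / 2) powr 0"
    using assms by (intro powr_less_mono') auto
  then show "(1 / 2 :: real) powr (2 * \<gamma>) < 1" by simp
qed

lemma bootstrap_const_ge_1:
  assumes "0 < \<gamma>" "\<gamma> < 1 / 3" "0 < \<Lambda>"
  shows "bootstrap_const TYPE('n::finite) \<Lambda> \<gamma> \<ge> 1"
proof -
  have "\<Lambda> * (2 * (1 / 2) powr (2 * \<gamma> / (1 - \<gamma>)) / (2 * (1 / 2) powr (2 * \<gamma> / (1 - \<gamma>)) - 1)) \<ge> 0"
    "\<Lambda> * (1 / (1 - (1 / 2) powr (2 * \<gamma>))) \<ge> 0"
    using bootstrap_ratio[OF assms(1,2)] assms(3) by auto
  then show ?thesis
    unfolding bootstrap_const_def using interior_const_ge_1[where 'n='n]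
    by (intro mult_ge1_I) auto
qed

text \<open>Growth of order \<open>q\<close> bounds the Laplacian on the ball of radius
  \<open>(1 / 2) ^ k\<close> by a geometric sequence \<open>\<eta> k\<close>. Both sums in
  \<open>dyadic_growth\<close> are then comparable to their terms at scale \<open>k\<close>, and the
  factor \<open>\<rho> ^ k\<close> is the gain of \<open>\<gamma> * q\<close> over quadratic
  growth.\<close>

lemma growth_bootstrap:
  fixes v :: "real^'n \<Rightarrow> real"
  assumes \<gamma>: "0 < \<gamma>" "\<gamma> < 1 / 3" and \<Lambda>: "0 < \<Lambda>"
    and v: "sublinear_visc \<Lambda> \<gamma> v" "\<And>x. norm x < 1 \<Longrightarrow> \<bar>v x\<bar> \<le> 1" "vanishes_second_order v"
    and q: "2 \<le> q" "q \<le> 2 / (1 - \<gamma>)" and B: "1 \<le> B"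
    and vq: "\<And>x. norm x < 1 \<Longrightarrow> \<bar>v x\<bar> \<le> B * norm x powr q"
    and x: "norm x < 1"
  shows "\<bar>v x\<bar> \<le> bootstrap_const TYPE('n) \<Lambda> \<gamma> * B powr \<gamma> * norm x powr (2 + \<gamma> * q)"
proof -
  define a where "a = \<gamma> * q"
  define C where "C = interior_const TYPE('n)"
  define M1 where "M1 = 2 * (1 / 2) powr (2 * \<gamma> / (1 - \<gamma>)) / (2 * (1 / 2) powr (2 * \<gamma> / (1 - \<gamma>)) - 1 :: real)"
  define M2 where "M2 = 1 / (1 - (1 / 2) powr (2 * \<gamma>) :: real)"
  define M where "M = 50 * C * (1 + \<Lambda> * M1 + \<Lambda> * M2)"
  have K: "bootstrap_const TYPE('n) \<Lambda> \<gamma> = 4096 * M"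
    by (simp add: bootstrap_const_def M_def C_def M1_def M2_def)
  have K1: "4096 * M \<ge> 1" using bootstrap_const_ge_1[OF \<gamma> \<Lambda>, where 'n='n] K by simp
  have C: "C \<ge> 1" unfolding C_def by (rule interior_const_ge_1)
  have a: "2 * \<gamma> \<le> a" "a \<le> 2 * \<gamma> / (1 - \<gamma>)" "0 < a" "a < 1"
  proof -
    show "2 * \<gamma> \<le> a" using q \<gamma> by (simp add: a_def)
    then show "0 < a" using \<gamma> by simp
    have "a \<le> \<gamma> * (2 / (1 - \<gamma>))" unfolding a_def using q \<gamma> by (intro mult_left_mono) auto
    then show "a \<le> 2 * \<gamma> / (1 - \<gamma>)" by (simp add: mult.commute)
    also have "\<dots> < 1" using \<gamma> by (simp add: field_simps)
    finally show "a < 1" .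
  qed
  have Bg: "B powr \<gamma> \<ge> 1" using B \<gamma> by (simp add: ge_one_powr_ge_zero)
  define \<rho> where "\<rho> = (1 / 2 :: real) powr a"
  have \<rho>: "0 < \<rho>" "\<rho> \<le> (1 / 2) powr (2 * \<gamma>)" "(1 / 2) powr (2 * \<gamma> / (1 - \<gamma>)) \<le> \<rho>" "\<rho> \<le> 1" "1 / 2 \<le> \<rho>"
  proof -
    show "0 < \<rho>" by (simp add: \<rho>_def)
    show "\<rho> \<le> (1 / 2) powr (2 * \<gamma>)" "(1 / 2) powr (2 * \<gamma> / (1 - \<gamma>)) \<le> \<rho>"
      unfolding \<rho>_def using a by (auto intro!: powr_mono')
    then show "\<rho> \<le> 1" "1 / 2 \<le> \<rho>" using bootstrap_ratio[OF \<gamma>] by auto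
  qed
  have \<rho>k: "((1 / 2) ^ k) powr a = \<rho> ^ k" for k :: nat
    unfolding \<rho>_def by (simp add: powr_power powr_powr mult.commute flip: powr_realpow)
  have M12: "M1 \<ge> 0" "M2 \<ge> 0" unfolding M1_def M2_def using bootstrap_ratio[OF \<gamma>] by auto
  have M: "M \<ge> 0" unfolding M_def using C \<Lambda> M12 by auto
  define \<eta> where "\<eta> k = \<Lambda> * B powr \<gamma> * \<rho> ^ k" for k :: nat
  have \<eta>: "\<eta> k > 0" "\<eta> (Suc k) \<le> \<eta> k" for k
    using \<Lambda> B \<rho> by (auto simp: \<eta>_def mult_left_le_one_le)
  have vb: "visc_bounded ((1 / 2) ^ k) (\<eta> k) v" if k: "1 \<le> k" for k :: nat
  proof -
    have r: "(0::real) < (1 / 2) ^ k" "(1 / 2 :: real) ^ k < 1" using k by (auto simp: power_less_one_iff)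
    have "\<Lambda> * \<bar>v y\<bar> powr \<gamma> \<le> \<eta> k" if y: "y \<in> ball 0 ((1 / 2) ^ k)" for y
    proof -
      have "\<bar>v y\<bar> powr \<gamma> \<le> (B * norm y powr q) powr \<gamma>"
        using y r vq[of y] \<gamma> by (intro powr_mono2) auto
      also have "\<dots> = B powr \<gamma> * norm y powr a"
        using B by (simp add: powr_mult powr_powr a_def mult.commute)
      also have "\<dots> \<le> B powr \<gamma> * ((1 / 2) ^ k) powr a"
        using y a by (intro mult_left_mono powr_mono2) auto
      finally show ?thesis using \<Lambda> by (simp add: \<rho>k \<eta>_def)
    qed
    then show ?thesis using v(1) r unfolding sublinear_visc_def by blast
  qed
  have dyadic: "\<bar>v y\<bar> \<le> M * B powr \<gamma> * ((1 / 2) ^ k)\<^sup>2 * \<rho> ^ k"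
    if k: "1 \<le> k" and y: "norm y \<le> (1 / 2) ^ (k + 3)" for k :: nat and y
  proof (rule field_le_epsilon)
    fix e :: real assume e: "e > 0"
    \<comment> \<open>Any \<epsilon> is allowed, since the scale \<open>m\<close> is free; this one
      turns the \<epsilon>-term of \<open>dyadic_growth\<close> into at most
      \<open>e\<close>.\<close>
    define \<epsilon> where "\<epsilon> = e / (50 * C)"
    have \<epsilon>: "\<epsilon> > 0" using e C by (simp add: \<epsilon>_def)
    obtain \<delta> where \<delta>: "\<delta> > 0" "\<And>x. norm x < \<delta> \<Longrightarrow> \<bar>v x\<bar> \<le> \<epsilon> * (norm x)\<^sup>2"
      using v(3) \<epsilon> unfolding vanishes_second_order_def by blast
    obtain m0 where m0: "(1 / 2 :: real) ^ m0 < \<delta>" using real_arch_pow_inv[OF \<delta>(1), of "1 / 2"] by auto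
    define m where "m = max m0 k"
    have m: "(1 / 2 :: real) ^ m < \<delta>" "k \<le> m"
    proof -
      have "(1 / 2 :: real) ^ m \<le> (1 / 2) ^ m0" by (intro power_decreasing) (auto simp: m_def)
      then show "(1 / 2 :: real) ^ m < \<delta>" using m0 by (rule le_less_trans)
    qed (simp add: m_def)
    have small: "\<bar>v x\<bar> \<le> \<epsilon> * ((1 / 2) ^ m)\<^sup>2" if "norm x \<le> (1 / 2) ^ m" for x
    proof -
      have "\<bar>v x\<bar> \<le> \<epsilon> * (norm x)\<^sup>2" using \<delta>(2) that m by simp
      also have "\<dots> \<le> \<epsilon> * ((1 / 2) ^ m)\<^sup>2" using that \<epsilon> by (intro mult_left_mono power_mono) auto
      finally show ?thesis .
    qed
    have cont: "continuous_on (ball 0 1) v" using v(1) by (simp add: sublinear_visc_def)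
    have "\<bar>v y\<bar> \<le> 50 * C * ((1 / 2) ^ k)\<^sup>2 *
       ((1 / 2) ^ k * (1 + (\<Sum>j=1..k. \<eta> j / (1 / 2) ^ j)) + (\<Sum>j=k..m. \<eta> j) + \<epsilon>)"
      unfolding C_def by (rule dyadic_growth[OF cont v(2) vb \<eta> k m(2) small y])
    also have "\<dots> \<le> 50 * C * ((1 / 2) ^ k)\<^sup>2 * ((1 + \<Lambda> * M1 + \<Lambda> * M2) * (B powr \<gamma> * \<rho> ^ k) + \<epsilon>)"
    proof (rule mult_left_mono)
      have "(\<Sum>j=1..k. \<eta> j / (1 / 2) ^ j) = \<Lambda> * B powr \<gamma> * (\<Sum>j=1..k. (2 * \<rho>) ^ j)"
        by (simp add: \<eta>_def sum_distrib_left power_mult_distrib power_one_over field_simps)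
      also have "\<dots> \<le> \<Lambda> * B powr \<gamma> * (M1 * (2 * \<rho>) ^ k)"
        unfolding M1_def using \<Lambda> B \<rho> bootstrap_ratio[OF \<gamma>]
        by (intro mult_left_mono sum_power_increasing_le) auto
      finally have "(1 / 2) ^ k * (\<Sum>j=1..k. \<eta> j / (1 / 2) ^ j) \<le> (1 / 2) ^ k * (\<Lambda> * B powr \<gamma> * (M1 * (2 * \<rho>) ^ k))"
        by (intro mult_left_mono) auto
      also have "\<dots> = \<Lambda> * M1 * (B powr \<gamma> * \<rho> ^ k)"
        by (simp add: power_mult_distrib power_one_over field_simps)
      finally have 1: "(1 / 2) ^ k * (\<Sum>j=1..k. \<eta> j / (1 / 2) ^ j) \<le> \<Lambda> * M1 * (B powr \<gamma> * \<rho> ^ k)" .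
      have "(\<Sum>j=k..m. \<eta> j) = \<Lambda> * B powr \<gamma> * (\<Sum>j=k..m. \<rho> ^ j)"
        by (simp add: \<eta>_def sum_distrib_left)
      also have "\<dots> \<le> \<Lambda> * B powr \<gamma> * (M2 * \<rho> ^ k)"
        unfolding M2_def using \<Lambda> B \<rho> bootstrap_ratio[OF \<gamma>]
        by (intro mult_left_mono sum_power_decreasing_le) auto
      finally have 2: "(\<Sum>j=k..m. \<eta> j) \<le> \<Lambda> * M2 * (B powr \<gamma> * \<rho> ^ k)" by (simp add: algebra_simps)
      \<comment> \<open>The contribution of the bound on \<open>v\<close> at the coarsest scale is
        cubic, hence dominated by the others, because \<open>\<rho>\<close> is at least 1/2.\<close>
      have "(1 / 2) ^ k \<le> 1 * \<rho> ^ k" using \<rho> by (simp add: power_mono)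
      also have "\<dots> \<le> B powr \<gamma> * \<rho> ^ k" using \<rho> Bg by (intro mult_right_mono) auto
      finally show "(1 / 2) ^ k * (1 + (\<Sum>j=1..k. \<eta> j / (1 / 2) ^ j)) + (\<Sum>j=k..m. \<eta> j) + \<epsilon>
         \<le> (1 + \<Lambda> * M1 + \<Lambda> * M2) * (B powr \<gamma> * \<rho> ^ k) + \<epsilon>"
        using 1 2 by (simp only: distrib_left distrib_right mult_1_left mult_1_right)
    qed (use C in simp)
    also have "\<dots> = M * B powr \<gamma> * ((1 / 2) ^ k)\<^sup>2 * \<rho> ^ k + e * ((1 / 2) ^ k)\<^sup>2"
      using C by (simp add: M_def \<epsilon>_def field_simps)
    also have "e * ((1 / 2) ^ k)\<^sup>2 \<le> e"
      using e by (simp add: mult_left_le power_le_one)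
    finally show "\<bar>v y\<bar> \<le> M * B powr \<gamma> * ((1 / 2) ^ k)\<^sup>2 * \<rho> ^ k + e" by simp
  qed
  show ?thesis
  proof (cases "x = 0")
    case True
    then show ?thesis using vq[of 0] by simp
  next
    case False
    then have x0: "norm x > 0" by simp
    have "16 powr (2 + a) \<le> (16 :: real) powr 3" using a by (intro powr_mono) auto
    then have p16: "16 powr (2 + a) \<le> (4096 :: real)" by simp
    show ?thesis
    proof (cases "norm x \<le> 1 / 16")
      case True
      obtain k where k: "1 \<le> k" "norm x \<le> (1 / 2) ^ (k + 3)" "(1 / 2) ^ k \<le> 16 * norm x"
        using dyadic_bracket[OF x0 True] by blast
      have "((1 / 2) ^ k)\<^sup>2 * \<rho> ^ k = ((1 / 2 :: real) ^ k) powr (2 + a)"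
        by (simp add: powr_add flip: \<rho>k)
      also have "\<dots> \<le> (16 * norm x) powr (2 + a)" using k a by (intro powr_mono2) auto
      also have "\<dots> = 16 powr (2 + a) * norm x powr (2 + a)" by (simp add: powr_mult)
      also have "\<dots> \<le> 4096 * norm x powr (2 + a)" using p16 by (intro mult_right_mono) auto
      finally have "M * B powr \<gamma> * (((1 / 2) ^ k)\<^sup>2 * \<rho> ^ k) \<le> M * B powr \<gamma> * (4096 * norm x powr (2 + a))"
        using M by (intro mult_left_mono) auto
      then show ?thesis using dyadic[OF k(1,2)] unfolding K a_def[symmetric] by (simp add: algebra_simps)
    next
      case False
      \<comment> \<open>Away from 0 the claimed bound is at least 1, so boundedness of
        \<open>v\<close> is enough.\<close>
      have "1 \<le> (16 * norm x) powr (2 + a)" using False a by (intro ge_one_powr_ge_zero) auto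
      also have "\<dots> = 16 powr (2 + a) * norm x powr (2 + a)" by (simp add: powr_mult)
      also have "\<dots> \<le> 4096 * norm x powr (2 + a)" using p16 by (intro mult_right_mono) auto
      finally have 1: "1 \<le> 4096 * norm x powr (2 + a)" .
      have "50 * 1 \<le> M"
        unfolding M_def using C \<Lambda> M12 by (intro mult_mono) (auto intro: mult_ge1_I)
      then have "1 \<le> M * B powr \<gamma>" using Bg by (intro mult_ge1_I) auto
      then have "1 * 1 \<le> M * B powr \<gamma> * (4096 * norm x powr (2 + a))"
        using 1 by (intro mult_mono) auto
      then show ?thesis using v(2)[OF x] unfolding K a_def[symmetric] by (simp add: algebra_simps)
    qed
  qed
qed

text \<open>The exponents \<open>q \<mapsto> 2 + \<gamma> q\<close> converge to the fixed point \<open>\<beta> = 2 / (1 - \<gamma>)\<close>, and the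
  constants \<open>B \<mapsto> C B\<^sup>\<gamma>\<close> to a limit that no longer depends on the initial one.\<close>

lemma critical_growth:
  fixes v :: "real^'n \<Rightarrow> real"
  assumes \<gamma>: "0 < \<gamma>" "\<gamma> < 1 / 3" and \<Lambda>: "0 < \<Lambda>"
    and v: "sublinear_visc \<Lambda> \<gamma> v" "\<And>x. norm x < 1 \<Longrightarrow> \<bar>v x\<bar> \<le> 1" "vanishes_second_order v"
    and x: "norm x < 1"
  shows "\<bar>v x\<bar> \<le> bootstrap_const TYPE('n) \<Lambda> \<gamma> powr (1 / (1 - \<gamma>)) * norm x powr (2 / (1 - \<gamma>))"
proof -
  define \<beta> where "\<beta> = 2 / (1 - \<gamma>)"
  define C where "C = bootstrap_const TYPE('n) \<Lambda> \<gamma>"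
  \<comment> \<open>The fixed point of the map from B to \<open>C * B powr \<gamma>\<close>. With
    \<open>K\<close> split off, only the factor \<open>B powr (\<gamma> ^ i)\<close> changes in the
    iteration.\<close>
  define K where "K = C powr (1 / (1 - \<gamma>))"
  have \<beta>: "2 < \<beta>" "2 + \<gamma> * \<beta> = \<beta>" unfolding \<beta>_def using growth_exponent[OF \<gamma>] by auto
  have C: "C \<ge> 1" unfolding C_def by (rule bootstrap_const_ge_1[OF \<gamma> \<Lambda>])
  have K: "K \<ge> 1" "C * K powr \<gamma> = K"
  proof -
    show "K \<ge> 1" unfolding K_def using C \<gamma> by (intro ge_one_powr_ge_zero) auto
    have "C * K powr \<gamma> = C powr (1 + \<gamma> / (1 - \<gamma>))" unfolding K_def using C by (simp add: powr_powr powr_add)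
    also have "1 + \<gamma> / (1 - \<gamma>) = 1 / (1 - \<gamma>)" using \<gamma> by (simp add: field_simps)
    finally show "C * K powr \<gamma> = K" by (simp add: K_def)
  qed
  obtain \<delta> where \<delta>: "\<delta> > 0" "\<And>x. norm x < \<delta> \<Longrightarrow> \<bar>v x\<bar> \<le> 1 * (norm x)\<^sup>2"
    using v(3) unfolding vanishes_second_order_def by (metis zero_less_one)
  \<comment> \<open>Within distance \<delta> the quadratic bound holds with constant 1; beyond it,
    the bound 1 on \<open>v\<close> is at most
    \<open>(norm y)\<^sup>2 / \<delta>\<^sup>2\<close>.\<close>
  define B where "B = 1 + 1 / \<delta>\<^sup>2"
  have B: "B \<ge> 1" by (simp add: B_def)
  have vB: "\<bar>v y\<bar> \<le> B * (norm y)\<^sup>2" if y: "norm y < 1" for y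
  proof (cases "norm y < \<delta>")
    case True
    have "1 * (norm y)\<^sup>2 \<le> B * (norm y)\<^sup>2" using B by (intro mult_right_mono) auto
    then show ?thesis using \<delta>(2)[OF True] by simp
  next
    case False
    then have "1 \<le> (norm y)\<^sup>2 / \<delta>\<^sup>2" using \<delta>(1) by (simp add: power_mono)
    also have "\<dots> \<le> B * (norm y)\<^sup>2" by (simp add: B_def algebra_simps)
    finally show ?thesis using v(2)[OF y] by simp
  qed
  have iter: "\<bar>v y\<bar> \<le> (K * B powr (\<gamma> ^ i)) * norm y powr (\<beta> - \<gamma> ^ i * (\<beta> - 2))"
    if "norm y < 1" for i y
    using that
  proof (induction i arbitrary: y)
    case 0
    have "1 * (B * (norm y)\<^sup>2) \<le> K * (B * (norm y)\<^sup>2)" using K B by (intro mult_right_mono) auto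
    then have "\<bar>v y\<bar> \<le> K * (B * (norm y)\<^sup>2)" using vB[OF 0] by simp
    then show ?case using B by (cases "y = 0") (auto simp: mult.assoc)
  next
    case (Suc i)
    define q where "q = \<beta> - \<gamma> ^ i * (\<beta> - 2)"
    have g: "0 \<le> \<gamma> ^ i" "\<gamma> ^ i \<le> 1" using \<gamma> by (auto simp: power_le_one)
    have "\<gamma> ^ i * (\<beta> - 2) \<le> 1 * (\<beta> - 2)" using g \<beta> by (intro mult_right_mono) auto
    moreover have "0 \<le> \<gamma> ^ i * (\<beta> - 2)" using g \<beta> by (intro mult_nonneg_nonneg) auto
    ultimately have q: "2 \<le> q" "q \<le> 2 / (1 - \<gamma>)" by (simp_all add: q_def \<beta>_def[symmetric])
    have Bi: "1 \<le> B powr (\<gamma> ^ i)" using B g by (intro ge_one_powr_ge_zero) auto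
    have KB: "1 \<le> K * B powr (\<gamma> ^ i)" using K Bi by (intro mult_ge1_I) auto
    have "\<bar>v y\<bar> \<le> C * (K * B powr (\<gamma> ^ i)) powr \<gamma> * norm y powr (2 + \<gamma> * q)"
      unfolding C_def
      by (rule growth_bootstrap[OF \<gamma> \<Lambda> v q KB Suc.IH[folded q_def] Suc.prems])
    also have "(K * B powr (\<gamma> ^ i)) powr \<gamma> = K powr \<gamma> * B powr (\<gamma> ^ Suc i)"
      using K by (simp add: powr_mult powr_powr mult.commute)
    also have "C * (K powr \<gamma> * B powr (\<gamma> ^ Suc i)) = K * B powr (\<gamma> ^ Suc i)"
      using K(2) by (metis mult.assoc)
    also have "2 + \<gamma> * q = \<beta> - \<gamma> ^ Suc i * (\<beta> - 2)" using \<beta>(2) by (simp add: q_def algebra_simps)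
    finally show ?case .
  qed
  have "\<bar>v x\<bar> \<le> K * norm x powr \<beta>"
  proof (cases "x = 0")
    case True
    then show ?thesis using vB[of 0] by simp
  next
    case False
    have "(\<lambda>i. \<gamma> ^ i) \<longlonglongrightarrow> 0" using \<gamma> by (intro LIMSEQ_power_zero) auto
    then have "(\<lambda>i. (K * B powr (\<gamma> ^ i)) * norm x powr (\<beta> - \<gamma> ^ i * (\<beta> - 2))) \<longlonglongrightarrow>
        (K * B powr 0) * norm x powr (\<beta> - 0 * (\<beta> - 2))"
      using False B \<gamma> by (intro tendsto_intros) auto
    then have "\<bar>v x\<bar> \<le> (K * B powr 0) * norm x powr (\<beta> - 0 * (\<beta> - 2))"
      by (rule LIMSEQ_le_const) (use iter[OF x] in blast)
    then show ?thesis using B by simp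
  qed
  then show ?thesis by (simp add: K_def C_def \<beta>_def)
qed

subsection \<open>Viscosity solutions of the equation\<close>

text \<open>Its absolute value drives the growth estimate, its sign the dead core argument, and its
  oddness exchanges sub- and supersolutions.\<close>

definition signed_power :: "real \<Rightarrow> real \<Rightarrow> real" where
  "signed_power \<gamma> t = pos_part t powr \<gamma> - neg_part t powr \<gamma>"

lemma signed_power_simps:
  "0 \<le> t \<Longrightarrow> signed_power \<gamma> t = t powr \<gamma>" "signed_power \<gamma> (- t) = - signed_power \<gamma> t"
  "\<bar>signed_power \<gamma> t\<bar> = \<bar>t\<bar> powr \<gamma>"
  by (auto simp: signed_power_def pos_part_def neg_part_def max_def)

definition visc_subsolution :: "(real^'n) set \<Rightarrow> real \<Rightarrow> (real^'n \<Rightarrow> real) \<Rightarrow> bool" where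
  "visc_subsolution \<Omega> \<gamma> u \<longleftrightarrow> (\<forall>\<phi> U x. real_polynomial_function \<phi> \<and> open U \<and> U \<subseteq> \<Omega> \<and> x \<in> U \<and>
     \<phi> x = u x \<and> (\<forall>y\<in>U. u y \<le> \<phi> y) \<longrightarrow> signed_power \<gamma> (u x) \<le> laplacian \<phi> x)"

lemma viscosity_solution_imp_subsolution:
  assumes "viscosity_solution \<Omega> (\<lambda>t. pos_part t powr \<gamma> - neg_part t powr \<gamma>) u"
  shows "visc_subsolution \<Omega> \<gamma> u"
  using assms unfolding viscosity_solution_def visc_subsolution_def
  by (auto simp: signed_power_def C2_on_polynomial)

lemma viscosity_solution_imp_supersolution:
  fixes u :: "real^'n \<Rightarrow> real"
  assumes u: "viscosity_solution \<Omega> (\<lambda>t. pos_part t powr \<gamma> - neg_part t powr \<gamma>) u"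
  shows "visc_subsolution \<Omega> \<gamma> (\<lambda>x. - u x)"
  unfolding visc_subsolution_def
proof (intro allI impI, elim conjE)
  fix \<phi> :: "real^'n \<Rightarrow> real" and U x
  assume *: "real_polynomial_function \<phi>" "open U" "U \<subseteq> \<Omega>" "x \<in> U" "\<phi> x = - u x" "\<forall>y\<in>U. - u y \<le> \<phi> y"
  have p: "real_polynomial_function (\<lambda>y. - \<phi> y)" using * by blast
  have "C2_on U (\<lambda>y. - \<phi> y)" by (rule C2_on_polynomial[OF p])
  moreover have "- \<phi> x = u x" using * by simp
  moreover have "\<forall>y\<in>U. - \<phi> y \<le> u y" using *(6) by force
  ultimately have "laplacian (\<lambda>y. - \<phi> y) x \<le> signed_power \<gamma> (u x)"
    using u *(2,3,4) unfolding viscosity_solution_def signed_power_def by blast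
  then show "signed_power \<gamma> (- u x) \<le> laplacian \<phi> x"
    using laplacian_cmult[OF *(1), of "-1" x] by (simp add: signed_power_simps)
qed

section \<open>Affine rescaling of the equation, and decay at branching points\<close>

lemma polynomial_affine:
  fixes f :: "real^'n \<Rightarrow> real"
  assumes "real_polynomial_function f"
  shows "real_polynomial_function (\<lambda>x. f (c *\<^sub>R (x - a)))"
proof -
  have "polynomial_function (\<lambda>x::real^'n. c *\<^sub>R (x - a))"
    by (intro polynomial_function_cmul polynomial_function_diff) auto
  then show ?thesis using real_polynomial_function_compose[OF _ assms] by (simp add: o_def)
qed

lemma dderiv_affine:
  fixes f :: "real^'n \<Rightarrow> real"
  assumes "real_polynomial_function f"
  shows "dderiv e (\<lambda>x. f (c *\<^sub>R (x - a))) = (\<lambda>x. c * dderiv e f (c *\<^sub>R (x - a)))"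
proof
  fix x
  have "((\<lambda>x. f (c *\<^sub>R (x - a))) has_derivative (\<lambda>e. dderiv (c *\<^sub>R e) f (c *\<^sub>R (x - a)))) (at x)"
    by (rule has_derivative_compose[OF _ has_derivative_dderiv[OF assms]])
       (auto intro!: derivative_eq_intros)
  then have "dderiv e (\<lambda>x. f (c *\<^sub>R (x - a))) x = dderiv (c *\<^sub>R e) f (c *\<^sub>R (x - a))" by (rule dderiv_eqI)
  then show "dderiv e (\<lambda>x. f (c *\<^sub>R (x - a))) x = c * dderiv e f (c *\<^sub>R (x - a))"
    using linear_scale[OF has_derivative_linear[OF has_derivative_dderiv[OF assms]]] by simp
qed

lemma laplacian_affine:
  fixes f :: "real^'n \<Rightarrow> real"
  assumes "real_polynomial_function f"
  shows "laplacian (\<lambda>x. f (c *\<^sub>R (x - a))) x = c\<^sup>2 * laplacian f (c *\<^sub>R (x - a))"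
  unfolding laplacian_eq[OF polynomial_affine[OF assms]] laplacian_eq[OF assms]
  by (simp only: polynomial_affine assms dderiv_affine polynomial_dderiv dderiv_cmult
      sum_distrib_left power2_eq_square mult.assoc)

text \<open>The rescaled function solves the equation with coefficient
  \<open>s\<^sup>2 * M powr (\<gamma> - 1)\<close>. A test function for it is carried back to one
  for \<open>u\<close> by the inverse rescaling.\<close>

lemma visc_sub_rescale:
  fixes u :: "real^'n \<Rightarrow> real"
  assumes u: "visc_subsolution \<Omega> \<gamma> u" and s: "0 < s" "ball x0 s \<subseteq> \<Omega>" and M: "0 < M"
    and r: "r < 1" and \<eta>: "\<And>x. x \<in> ball 0 r \<Longrightarrow> s\<^sup>2 * M powr (\<gamma> - 1) * \<bar>u (x0 + s *\<^sub>R x) / M\<bar> powr \<gamma> \<le> \<eta>"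
  shows "visc_sub r \<eta> (\<lambda>x. u (x0 + s *\<^sub>R x) / M)"
  unfolding visc_sub_def
proof (intro allI impI, elim conjE)
  fix \<phi> :: "real^'n \<Rightarrow> real" and U z
  assume *: "real_polynomial_function \<phi>" "open U" "U \<subseteq> ball 0 r" "z \<in> U"
    "\<phi> z = u (x0 + s *\<^sub>R z) / M" "\<forall>y\<in>U. u (x0 + s *\<^sub>R y) / M \<le> \<phi> y"
  define \<psi> where "\<psi> = (\<lambda>y. M * \<phi> ((1 / s) *\<^sub>R (y - x0)))"
  define V where "V = (\<lambda>y. (1 / s) *\<^sub>R (y - x0)) -` U"
  have inv: "x0 + s *\<^sub>R ((1 / s) *\<^sub>R (y - x0)) = y" for y using s by simp
  have "real_polynomial_function \<psi>"
    unfolding \<psi>_def by (intro polynomial_mult polynomial_const polynomial_affine *)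
  moreover have "open V" unfolding V_def by (rule open_vimage[OF *(2)]) (intro continuous_intros)
  moreover have "V \<subseteq> \<Omega>"
  proof
    fix y assume "y \<in> V"
    then have "norm ((1 / s) *\<^sub>R (y - x0)) < 1" using *(3) r by (auto simp: V_def subset_iff)
    then have "norm (y - x0) < s" using s unfolding norm_scaleR by (simp add: field_simps)
    then have "y \<in> ball x0 s" by (simp add: dist_norm norm_minus_commute)
    then show "y \<in> \<Omega>" using s by blast
  qed
  moreover have "x0 + s *\<^sub>R z \<in> V" using * s by (simp add: V_def)
  moreover have "\<psi> (x0 + s *\<^sub>R z) = u (x0 + s *\<^sub>R z)" using * s M by (simp add: \<psi>_def)
  moreover have "\<forall>y\<in>V. u y \<le> \<psi> y"
  proof
    fix y assume "y \<in> V"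
    then have "u (x0 + s *\<^sub>R ((1 / s) *\<^sub>R (y - x0))) / M \<le> \<phi> ((1 / s) *\<^sub>R (y - x0))" using *(6) by (auto simp only: V_def vimage_eq)
    then show "u y \<le> \<psi> y" unfolding inv using M by (simp add: \<psi>_def field_simps)
  qed
  ultimately have "signed_power \<gamma> (u (x0 + s *\<^sub>R z)) \<le> laplacian \<psi> (x0 + s *\<^sub>R z)"
    using u unfolding visc_subsolution_def by blast
  also have "\<dots> = M * ((1 / s)\<^sup>2 * laplacian \<phi> z)"
    unfolding \<psi>_def laplacian_cmult[OF polynomial_affine[OF *(1)]] laplacian_affine[OF *(1)] using s by simp
  finally have "(s\<^sup>2 / M) * signed_power \<gamma> (u (x0 + s *\<^sub>R z)) \<le> (s\<^sup>2 / M) * (M * ((1 / s)\<^sup>2 * laplacian \<phi> z))"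
    using M by (intro mult_left_mono) auto
  also have "\<dots> = laplacian \<phi> z" using s M by (simp add: field_simps)
  finally have 1: "(s\<^sup>2 / M) * signed_power \<gamma> (u (x0 + s *\<^sub>R z)) \<le> laplacian \<phi> z" .
  have "- (\<bar>u (x0 + s *\<^sub>R z)\<bar> powr \<gamma>) \<le> signed_power \<gamma> (u (x0 + s *\<^sub>R z))"
    using signed_power_simps(3)[of \<gamma> "u (x0 + s *\<^sub>R z)"] by linarith
  then have "(s\<^sup>2 / M) * - (\<bar>u (x0 + s *\<^sub>R z)\<bar> powr \<gamma>) \<le> (s\<^sup>2 / M) * signed_power \<gamma> (u (x0 + s *\<^sub>R z))"
    using M by (intro mult_left_mono) auto
  moreover have "(s\<^sup>2 / M) * \<bar>u (x0 + s *\<^sub>R z)\<bar> powr \<gamma> \<le> \<eta>"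
  proof -
    have "M powr (\<gamma> - 1) * \<bar>u (x0 + s *\<^sub>R z) / M\<bar> powr \<gamma> = \<bar>u (x0 + s *\<^sub>R z)\<bar> powr \<gamma> / M"
      using M by (simp add: powr_divide powr_diff abs_divide)
    moreover have "z \<in> ball 0 r" using * by blast
    ultimately show ?thesis using \<eta>[of z] by (simp add: mult.assoc)
  qed
  ultimately show "- \<eta> \<le> laplacian \<phi> z" using 1 by linarith
qed

text \<open>The gradient vanishes at \<open>x0\<close> together with its derivative, so it is
  \<open>o(|x - x0|)\<close>; the mean value inequality on a ball around \<open>x0\<close>
  integrates this to the quadratic rate.\<close>

lemma branching_point_quadratic_decay:
  fixes u :: "real^'n \<Rightarrow> real"
  assumes b: "branching_point u x0" and \<epsilon>: "\<epsilon> > 0"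
  obtains \<delta> where "\<delta> > 0" "\<And>x. norm (x - x0) < \<delta> \<Longrightarrow> \<bar>u x\<bar> \<le> \<epsilon> * (norm (x - x0))\<^sup>2"
proof -
  have t: "\<forall>\<^sub>F y in nhds x0. u differentiable (at y)" "gradient u differentiable (at x0)"
    and z: "u x0 = 0" "gradient u x0 = 0" "hessian u x0 = 0"
    using b by (auto simp: branching_point_def twice_differentiable_at_def)
  let ?L = "frechet_derivative (gradient u) (at x0)"
  have L: "(gradient u has_derivative ?L) (at x0)" using t(2) by (simp add: frechet_derivative_works)
  then have "matrix ?L *v h = ?L h" for h by (simp add: matrix_works has_derivative_linear)
  then have "?L h = 0" for h using z(3) by (metis hessian_def jacobian_def matrix_vector_mult_0)
  then obtain d where d: "d > 0" "\<And>y. norm (y - x0) < d \<Longrightarrow> norm (gradient u y) \<le> \<epsilon> * norm (y - x0)"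
    using L \<epsilon> z(2) unfolding has_derivative_at_alt by (metis diff_zero)
  obtain d' where d': "d' > 0" "\<And>y. dist y x0 < d' \<Longrightarrow> u differentiable (at y)"
    using t(1) unfolding eventually_nhds_metric by blast
  show thesis
  proof (rule that[of "min d d'"])
    show "min d d' > 0" using d d' by simp
    fix x assume x: "norm (x - x0) < min d d'"
    have "norm (u x - u x0) \<le> (\<epsilon> * norm (x - x0)) * norm (x - x0)"
    proof (rule differentiable_bound[where S="cball x0 (norm (x - x0))" and f'="\<lambda>y. frechet_derivative u (at y)"])
      fix y assume y: "y \<in> cball x0 (norm (x - x0))"
      then have y': "norm (y - x0) \<le> norm (x - x0)" by (simp add: dist_norm norm_minus_commute)
      have ud: "(u has_derivative frechet_derivative u (at y)) (at y)"
        using d'(2)[of y] y' x by (simp add: dist_norm frechet_derivative_works)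
      then show "(u has_derivative frechet_derivative u (at y)) (at y within cball x0 (norm (x - x0)))"
        by (rule has_derivative_at_withinI)
      have "frechet_derivative u (at y) e = e \<bullet> gradient u y" for e
      proof -
        have lin: "linear (frechet_derivative u (at y))" using ud by (rule has_derivative_linear)
        have "frechet_derivative u (at y) e = frechet_derivative u (at y) (\<Sum>i\<in>UNIV. e $ i *\<^sub>R axis i 1)"
          by (simp add: basis_expansion flip: scalar_mult_eq_scaleR)
        also have "\<dots> = (\<Sum>i\<in>UNIV. e $ i * frechet_derivative u (at y) (axis i 1))"
          by (simp add: linear_sum[OF lin] linear_scale[OF lin])
        also have "\<dots> = e \<bullet> gradient u y" by (simp add: inner_vec_def gradient_def)
        finally show ?thesis .
      qed
      moreover have "norm (e \<bullet> gradient u y) \<le> \<epsilon> * norm (x - x0) * norm e" for e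
      proof -
        have "norm (e \<bullet> gradient u y) \<le> norm e * norm (gradient u y)" using Cauchy_Schwarz_ineq2 by simp
        also have "\<dots> \<le> norm e * (\<epsilon> * norm (x - x0))"
        proof (rule mult_left_mono)
          have "norm (gradient u y) \<le> \<epsilon> * norm (y - x0)" using d(2)[of y] y' x by simp
          also have "\<dots> \<le> \<epsilon> * norm (x - x0)" using y' \<epsilon> by simp
          finally show "norm (gradient u y) \<le> \<epsilon> * norm (x - x0)" .
        qed simp
        finally have "norm (e \<bullet> gradient u y) \<le> norm e * (\<epsilon> * norm (x - x0))" .
        then show ?thesis by (simp add: mult.commute)
      qed
      ultimately show "onorm (frechet_derivative u (at y)) \<le> \<epsilon> * norm (x - x0)"
        using \<epsilon> by (intro onorm_bound) auto
    qed (auto simp: dist_norm norm_minus_commute)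
    then show "\<bar>u x\<bar> \<le> \<epsilon> * (norm (x - x0))\<^sup>2" using z by (simp add: power2_eq_square)
  qed
qed

text \<open>\<open>M\<close> is any bound for \<open>u\<close> on the ball and \<open>s\<close> is
  free, so this serves both the uniform estimate, with \<open>s = 1 / 2\<close>, and the local one
  at any point of \<Omega>.\<close>

lemma branching_point_growth:
  fixes u :: "real^'n \<Rightarrow> real"
  assumes \<gamma>: "0 < \<gamma>" "\<gamma> < 1 / 3" and \<Lambda>: "0 < \<Lambda>"
    and u: "viscosity_solution \<Omega> (\<lambda>t. pos_part t powr \<gamma> - neg_part t powr \<gamma>) u"
    and b: "branching_point u x0" and s: "0 < s" "ball x0 s \<subseteq> \<Omega>"
    and M: "0 < M" "\<And>x. x \<in> ball x0 s \<Longrightarrow> \<bar>u x\<bar> \<le> M" "s\<^sup>2 * M powr (\<gamma> - 1) \<le> \<Lambda>"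
    and x: "x \<in> ball x0 s"
  shows "\<bar>u x\<bar> \<le> M * bootstrap_const TYPE('n) \<Lambda> \<gamma> powr (1 / (1 - \<gamma>)) * (norm (x - x0) / s) powr (2 / (1 - \<gamma>))"
proof -
  define v where "v = (\<lambda>y. u (x0 + s *\<^sub>R y) / M)"
  have in_ball: "x0 + s *\<^sub>R y \<in> ball x0 s" if "norm y < 1" for y
    using that s by (simp add: dist_norm)
  have "continuous_on (ball 0 1) v"
  proof -
    have "continuous_on (ball x0 s) u"
      using u s(2) unfolding viscosity_solution_def by (meson continuous_on_subset)
    then have "continuous_on (ball 0 1) (\<lambda>y. u (x0 + s *\<^sub>R y))"
      by (rule continuous_on_compose2) (use in_ball in \<open>auto intro!: continuous_intros\<close>)
    then show ?thesis unfolding v_def using M by (intro continuous_intros) auto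
  qed
  moreover have "visc_bounded r \<eta> v"
    if r: "0 < r" "r < 1" and \<eta>: "\<forall>x\<in>ball 0 r. \<Lambda> * \<bar>v x\<bar> powr \<gamma> \<le> \<eta>" for r \<eta>
  proof -
    have \<eta>': "s\<^sup>2 * M powr (\<gamma> - 1) * \<bar>u (x0 + s *\<^sub>R x) / M\<bar> powr \<gamma> \<le> \<eta>" if "x \<in> ball 0 r" for x
    proof -
      have "s\<^sup>2 * M powr (\<gamma> - 1) * \<bar>v x\<bar> powr \<gamma> \<le> \<Lambda> * \<bar>v x\<bar> powr \<gamma>"
        using M(3) by (intro mult_right_mono) auto
      then show ?thesis using \<eta> that by (fastforce simp: v_def)
    qed
    have "visc_sub r \<eta> v"
      unfolding v_def
      by (rule visc_sub_rescale[OF viscosity_solution_imp_subsolution[OF u] s M(1) r(2) \<eta>'])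
    moreover have "visc_sub r \<eta> (\<lambda>x. - u (x0 + s *\<^sub>R x) / M)"
      by (rule visc_sub_rescale[OF viscosity_solution_imp_supersolution[OF u] s M(1) r(2)]) (use \<eta>' in simp)
    ultimately show ?thesis by (simp add: visc_bounded_def v_def)
  qed
  ultimately have sub: "sublinear_visc \<Lambda> \<gamma> v" by (simp add: sublinear_visc_def)
  have v1: "\<bar>v y\<bar> \<le> 1" if "norm y < 1" for y
    using M(1,2) in_ball[OF that] by (simp add: v_def)
  have v2: "vanishes_second_order v"
    unfolding vanishes_second_order_def
  proof (intro allI impI)
    fix \<epsilon> :: real assume \<epsilon>: "\<epsilon> > 0"
    then have "\<epsilon> * M / s\<^sup>2 > 0" using M s by simp
    then obtain \<delta> where \<delta>: "\<delta> > 0" "\<And>x. norm (x - x0) < \<delta> \<Longrightarrow> \<bar>u x\<bar> \<le> \<epsilon> * M / s\<^sup>2 * (norm (x - x0))\<^sup>2"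
      using branching_point_quadratic_decay[OF b] by blast
    have "\<bar>v y\<bar> \<le> \<epsilon> * (norm y)\<^sup>2" if "norm y < \<delta> / s" for y
    proof -
      have "norm (x0 + s *\<^sub>R y - x0) = s * norm y" using s by simp
      moreover have "s * norm y < \<delta>" using that s by (simp add: field_simps)
      ultimately have "\<bar>u (x0 + s *\<^sub>R y)\<bar> \<le> \<epsilon> * M / s\<^sup>2 * (s * norm y)\<^sup>2" using \<delta>(2) by metis
      then show ?thesis using M s by (simp add: v_def field_simps)
    qed
    then show "\<exists>\<delta>>0. \<forall>x. norm x < \<delta> \<longrightarrow> \<bar>v x\<bar> \<le> \<epsilon> * (norm x)\<^sup>2"
      using \<delta>(1) s by (intro exI[of _ "\<delta> / s"]) auto
  qed
  define y where "y = (1 / s) *\<^sub>R (x - x0)"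
  have y: "norm y = norm (x - x0) / s" "norm y < 1" "x0 + s *\<^sub>R y = x"
    using s x by (auto simp: y_def dist_norm norm_minus_commute)
  have "\<bar>v y\<bar> \<le> bootstrap_const TYPE('n) \<Lambda> \<gamma> powr (1 / (1 - \<gamma>)) * norm y powr (2 / (1 - \<gamma>))"
    by (rule critical_growth[OF \<gamma> \<Lambda> sub v1 v2 y(2)])
  then show ?thesis using M(1) by (simp add: v_def y field_simps)
qed

subsection \<open>Dead cores of small solutions\<close>

text \<open>Subtract the paraboloid centred at \<open>y\<close> that reaches height \<open>m\<close>
  at radius \<rho>. The difference is positive at \<open>y\<close> and nonpositive on the boundary,
  so its maximum is interior; there the shifted paraboloid touches \<open>u\<close>, and
  \<open>u\<close> is at least \<open>u y\<close>.\<close>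

lemma paraboloid_bound:
  fixes u :: "real^'n \<Rightarrow> real"
  assumes \<gamma>: "0 < \<gamma>" and u: "visc_subsolution \<Omega> \<gamma> u" "continuous_on \<Omega> u" and \<rho>: "0 < \<rho>" "cball y \<rho> \<subseteq> \<Omega>"
    and m: "\<And>x. x \<in> cball y \<rho> \<Longrightarrow> u x \<le> m" and pos: "0 < u y"
  shows "u y powr \<gamma> \<le> 2 * real CARD('n) * m / \<rho>\<^sup>2"
proof -
  define \<phi> where "\<phi> = (\<lambda>x. m / \<rho>\<^sup>2 * ((1 *\<^sub>R (x - y)) \<bullet> (1 *\<^sub>R (x - y))))"
  have p0: "real_polynomial_function (\<lambda>x. (1 *\<^sub>R (x - y)) \<bullet> (1 *\<^sub>R (x - y)))"
    by (rule polynomial_affine[OF polynomial_inner_self])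
  have p: "real_polynomial_function \<phi>" unfolding \<phi>_def by (intro polynomial_mult polynomial_const p0)
  have l: "laplacian \<phi> x = 2 * real CARD('n) * m / \<rho>\<^sup>2" for x
    unfolding \<phi>_def laplacian_cmult[OF p0] laplacian_affine[OF polynomial_inner_self] laplacian_inner_self by simp
  have m0: "m > 0" using m[of y] pos \<rho> by simp
  have \<phi>: "\<phi> x = m / \<rho>\<^sup>2 * (norm (x - y))\<^sup>2" for x by (simp add: \<phi>_def dot_square_norm)
  have "continuous_on (cball y \<rho>) (\<lambda>x. u x - \<phi> x)"
    by (intro continuous_intros continuous_on_subset[OF u(2) \<rho>(2)] polynomial_continuous_on p)
  then obtain z where z: "z \<in> cball y \<rho>" "\<And>x. x \<in> cball y \<rho> \<Longrightarrow> u x - \<phi> x \<le> u z - \<phi> z"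
    using continuous_attains_sup[of "cball y \<rho>" "\<lambda>x. u x - \<phi> x"] \<rho> by fastforce
  have zy: "u y \<le> u z - \<phi> z" using z(2)[of y] \<rho> by (simp add: \<phi>)
  have "norm (z - y) \<noteq> \<rho>"
  proof
    assume "norm (z - y) = \<rho>"
    then have "\<phi> z = m" using \<rho> by (simp add: \<phi>)
    then show False using zy m[OF z(1)] pos by simp
  qed
  then have zb: "z \<in> ball y \<rho>" using z(1) by (auto simp: dist_norm norm_minus_commute)
  let ?\<psi> = "\<lambda>x. \<phi> x + (u z - \<phi> z)"
  have "real_polynomial_function ?\<psi>" using p by (intro polynomial_add polynomial_const)
  moreover have "?\<psi> z = u z" "\<forall>x\<in>ball y \<rho>. u x \<le> ?\<psi> x" using z(2) by (auto simp: algebra_simps)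
  moreover have "ball y \<rho> \<subseteq> \<Omega>" using \<rho>(2) ball_subset_cball by blast
  ultimately have "signed_power \<gamma> (u z) \<le> laplacian ?\<psi> z"
    using u(1) zb unfolding visc_subsolution_def by (meson open_ball)
  also have "\<dots> = 2 * real CARD('n) * m / \<rho>\<^sup>2" using p by (simp add: laplacian_add polynomial_const l)
  finally have 1: "signed_power \<gamma> (u z) \<le> 2 * real CARD('n) * m / \<rho>\<^sup>2" .
  have "\<phi> z \<ge> 0" using m0 by (simp add: \<phi>)
  then have uz: "u y \<le> u z" using zy by simp
  then have "u y powr \<gamma> \<le> u z powr \<gamma>" using pos \<gamma> by (intro powr_mono2) auto
  then show ?thesis using 1 uz pos by (simp add: signed_power_simps)
qed

text \<open>With \<open>N = 128 * n\<close>, the paraboloid bound at radius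
  \<open>(1 / 2) ^ k / 8\<close> multiplies the level by \<open>N * 2 ^ k\<close>, where 128 is
  \<open>2 * 8\<^sup>2\<close>. The square is chosen so that \<open>N\<close> times the level is
  still \<open>1 / N\<close>.\<close>

definition dead_core_level :: "'n::finite itself \<Rightarrow> real" where
  "dead_core_level _ = 1 / (128 * real CARD('n))\<^sup>2"

text \<open>Since \<open>1 / \<gamma> > 3\<close>, the paraboloid bound gains a cube, which beats the loss of radius
  when passing from the radius \<open>(1 + 2\<^sup>-\<^sup>k) / 4\<close> to the next one.\<close>

lemma small_solution_dead_core:
  fixes u :: "real^'n \<Rightarrow> real"
  assumes \<gamma>: "0 < \<gamma>" "\<gamma> < 1 / 3"
    and u: "viscosity_solution \<Omega> (\<lambda>t. pos_part t powr \<gamma> - neg_part t powr \<gamma>) u"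
    and ball: "ball x0 (1 / 2) \<subseteq> \<Omega>"
    and small: "\<And>x. x \<in> ball x0 (1 / 2) \<Longrightarrow> \<bar>u x\<bar> \<le> dead_core_level TYPE('n)"
    and x: "x \<in> ball x0 (1 / 4)"
  shows "u x = 0"
proof -
  define N where "N = 128 * real CARD('n)"
  define c where "c = 1 / N\<^sup>2"
  define R where "R k = (1 / 4 + (1 / 2) ^ k / 4 :: real)" for k :: nat
  have N: "N \<ge> 128" by (simp add: N_def Suc_le_eq)
  have c: "c > 0" "N * c = 1 / N" using N by (auto simp: c_def power2_eq_square)
  have cont: "continuous_on \<Omega> u" using u by (simp add: viscosity_solution_def)
  have "\<bar>u y\<bar> \<le> c * (1 / 8) ^ k" if "y \<in> ball x0 (R k)" for k y
    using that
  proof (induction k arbitrary: y)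
    case 0
    then show ?case using small[of y] by (simp add: R_def c_def N_def dead_core_level_def)
  next
    case (Suc k)
    define \<rho> where "\<rho> = (1 / 2) ^ k / (8 :: real)"
    define m where "m = c * (1 / 8) ^ k"
    have \<rho>: "\<rho> > 0" by (simp add: \<rho>_def)
    have RR: "R (Suc k) + \<rho> = R k" by (simp add: R_def \<rho>_def)
    have "cball y \<rho> \<subseteq> ball x0 (R k)"
    proof
      fix z assume "z \<in> cball y \<rho>"
      then show "z \<in> ball x0 (R k)"
        using Suc.prems dist_triangle[of x0 z y] RR by simp
    qed
    moreover have "R k \<le> 1 / 2" using power_le_one[of "1 / 2 :: real" k] by (simp add: R_def)
    ultimately have sub: "cball y \<rho> \<subseteq> \<Omega>" "\<And>z. z \<in> cball y \<rho> \<Longrightarrow> \<bar>u z\<bar> \<le> m"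
      using ball Suc.IH by (auto simp: m_def subset_iff)
    have "\<bar>u y\<bar> powr \<gamma> \<le> 2 * real CARD('n) * m / \<rho>\<^sup>2" if "u y \<noteq> 0"
    proof (cases "u y > 0")
      case True
      have "u y powr \<gamma> \<le> 2 * real CARD('n) * m / \<rho>\<^sup>2"
        by (rule paraboloid_bound[OF \<gamma>(1) viscosity_solution_imp_subsolution[OF u] cont \<rho> sub(1) _ True])
           (use sub(2) in force)
      then show ?thesis using True by simp
    next
      case False
      then have "0 < - u y" using that by simp
      then have "(- u y) powr \<gamma> \<le> 2 * real CARD('n) * m / \<rho>\<^sup>2"
        by (intro paraboloid_bound[OF \<gamma>(1) viscosity_solution_imp_supersolution[OF u] _ \<rho> sub(1)])
           (use sub(2) cont in \<open>force intro: continuous_intros\<close>)+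
      then show ?thesis using False by simp
    qed
    \<comment> \<open>Per step \<open>m\<close> shrinks by 8 and \<open>\<rho>\<^sup>2\<close> by 4,
      so this bound gains only a factor 1/2, whose cube is the 1/8 needed.\<close>
    moreover have "2 * real CARD('n) * m / \<rho>\<^sup>2 = (1 / N) * (1 / 2) ^ k"
    proof -
      have "2 * real CARD('n) * m / \<rho>\<^sup>2 = N * c * ((1 / 8) ^ k / ((1 / 2) ^ k)\<^sup>2)"
        by (simp add: m_def \<rho>_def N_def power_divide power2_eq_square)
      also have "((1 / 2 :: real) ^ k)\<^sup>2 = (1 / 4) ^ k" by (simp add: power2_eq_square flip: power_mult_distrib)
      also have "(1 / 8 :: real) ^ k / (1 / 4) ^ k = (1 / 2) ^ k" by (simp flip: power_divide)
      finally show ?thesis using c by simp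
    qed
    ultimately have *: "\<bar>u y\<bar> powr \<gamma> \<le> (1 / N) * (1 / 2) ^ k" if "u y \<noteq> 0" using that by simp
    show ?case
    proof (cases "u y = 0")
      case True
      then show ?thesis using c by simp
    next
      case False
      have "\<bar>u y\<bar> = (\<bar>u y\<bar> powr \<gamma>) powr (1 / \<gamma>)" using \<gamma> by (simp add: powr_powr)
      also have "\<dots> \<le> ((1 / N) * (1 / 2) ^ k) powr (1 / \<gamma>)" using * False \<gamma> by (intro powr_mono2) auto
      also have "\<dots> \<le> ((1 / N) * (1 / 2) ^ k) powr 3"
      proof (rule powr_mono')
        show "3 \<le> 1 / \<gamma>" using \<gamma> by (simp add: field_simps)
        show "1 / N * (1 / 2) ^ k \<le> 1" using N by (intro mult_le_one) (auto simp: power_le_one)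
      qed (use N in auto)
      also have "\<dots> = ((1 / N) * (1 / 2) ^ k) ^ 3" using N by (simp add: powr_numeral)
      also have "\<dots> = (1 / N) ^ 3 * (1 / 8) ^ k"
      proof -
        have "((1 / 2 :: real) ^ k) ^ 3 = ((1 / 2) ^ 3) ^ k" by (simp only: power_mult[symmetric] mult.commute)
        then show ?thesis by (simp add: power_mult_distrib power_divide)
      qed
      also have "\<dots> \<le> (c / 8) * (1 / 8) ^ k"
      proof (rule mult_right_mono)
        have "(1 / N) ^ 3 = c * (1 / N)" by (simp add: c_def power2_eq_square power3_eq_cube)
        also have "\<dots> \<le> c * (1 / 8)" using c N by (intro mult_left_mono) (auto simp: field_simps)
        finally show "(1 / N) ^ 3 \<le> c / 8" by simp
      qed simp
      finally show ?thesis by simp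
    qed
  qed
  moreover have "x \<in> ball x0 (R k)" for k
  proof -
    have "(1 / 2 :: real) ^ k > 0" by simp
    then show ?thesis using x unfolding R_def mem_ball by linarith
  qed
  ultimately have "\<bar>u x\<bar> \<le> c * (1 / 8) ^ k" for k by blast
  moreover have "(\<lambda>k. c * (1 / 8) ^ k) \<longlonglongrightarrow> c * 0"
    by (intro tendsto_intros LIMSEQ_power_zero) auto
  ultimately have "\<bar>u x\<bar> \<le> c * 0" by (intro LIMSEQ_le_const) auto
  then show ?thesis by simp
qed

text \<open>The part of \<open>U\<close> where the absolute value of \<open>u\<close> exceeds
  \<open>M\<close> is open by continuity and null by the definition of the essential supremum, hence
  empty.\<close>

lemma Linf_norm_bound_on_open:
  fixes u :: "real^'n \<Rightarrow> real"
  assumes U: "open U" "continuous_on U u" and M: "0 \<le> M" "Linf_norm u = ennreal M" and x: "x \<in> U"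
  shows "\<bar>u x\<bar> \<le> M"
proof (rule ccontr)
  assume "\<not> \<bar>u x\<bar> \<le> M"
  define W where "W = {y \<in> U. M < \<bar>u y\<bar>}"
  have "open W"
  proof -
    have "open (U \<inter> (\<lambda>y. \<bar>u y\<bar>) -` {M<..})"
      by (rule continuous_open_preimage) (use U in \<open>auto intro!: continuous_intros\<close>)
    moreover have "W = U \<inter> (\<lambda>y. \<bar>u y\<bar>) -` {M<..}" by (auto simp: W_def)
    ultimately show ?thesis by simp
  qed
  have "AE y in lebesgue. ennreal \<bar>u y\<bar> \<le> ennreal M"
    using esssup_AE[of "\<lambda>y. ennreal \<bar>u y\<bar>" lebesgue] M(2) by (simp add: Linf_norm_def)
  then have "AE y in lebesgue. y \<notin> W"
    by eventually_elim (use M(1) in \<open>auto simp: W_def\<close>)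
  moreover have "W \<in> sets lebesgue" using \<open>open W\<close> by auto
  ultimately have "W \<in> null_sets lebesgue" by (simp add: AE_iff_null_sets)
  then have "negligible W" by (simp add: negligible_iff_null_sets)
  moreover have "x \<in> W" using x \<open>\<not> \<bar>u x\<bar> \<le> M\<close> by (simp add: W_def)
  ultimately show False using open_not_negligible[OF \<open>open W\<close>] by blast
qed

section \<open>The uniform estimate, linear in the norm, and the local estimate\<close>

lemma powr_growth_le_cube:
  fixes t :: real
  assumes "0 < \<gamma>" "\<gamma> < 1 / 3" "1 \<le> t"
  shows "t powr (2 / (1 - \<gamma>)) \<le> t ^ 3"
proof -
  have "t powr (2 / (1 - \<gamma>)) \<le> t powr 3"
    using growth_exponent(2)[OF assms(1,2)] assms(3) by (intro powr_mono) auto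
  then show ?thesis using assms(3) by simp
qed

text \<open>The split is at the dead core level. Below it only distances of at least 1/4 matter, at
  the cost of \<open>4 powr \<beta> \<le> 64\<close>; above it, rescaling from radius 1/2 costs
  \<open>2 powr \<beta> \<le> 8\<close>.\<close>

lemma branching_point_growth_linear:
  fixes u :: "real^'n \<Rightarrow> real"
  assumes \<gamma>: "0 < \<gamma>" "\<gamma> < 1 / 3"
    and u: "viscosity_solution \<Omega> (\<lambda>t. pos_part t powr \<gamma> - neg_part t powr \<gamma>) u"
    and b: "branching_point u x0" and s: "ball x0 (1 / 2) \<subseteq> \<Omega>"
    and M: "0 \<le> M" "\<And>x. x \<in> ball x0 (1 / 2) \<Longrightarrow> \<bar>u x\<bar> \<le> M"
    and x: "x \<in> ball x0 (1 / 2)"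
  shows "\<bar>u x\<bar> \<le> (64 + 8 * bootstrap_const TYPE('n) (dead_core_level TYPE('n) powr (\<gamma> - 1)) \<gamma> powr (1 / (1 - \<gamma>)))
    * M * norm (x - x0) powr (2 / (1 - \<gamma>))"
proof -
  define c where "c = dead_core_level TYPE('n)"
  define \<beta> where "\<beta> = 2 / (1 - \<gamma>)"
  define K where "K = bootstrap_const TYPE('n) (c powr (\<gamma> - 1)) \<gamma> powr (1 / (1 - \<gamma>))"
  have c: "c > 0" by (simp add: c_def dead_core_level_def)
  have K: "K \<ge> 0" by (simp add: K_def)
  have \<beta>: "\<beta> > 2" unfolding \<beta>_def by (rule growth_exponent(1)[OF \<gamma>])
  have "\<bar>u x\<bar> \<le> (64 + 8 * K) * (M * norm (x - x0) powr \<beta>)"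
  proof (cases "M \<le> c")
    case True
    show ?thesis
    proof (cases "x \<in> ball x0 (1 / 4)")
      case inside: True
      have "\<bar>u y\<bar> \<le> dead_core_level TYPE('n)" if "y \<in> ball x0 (1 / 2)" for y
        using M(2)[OF that] True by (simp add: c_def)
      then have "u x = 0" by (rule small_solution_dead_core[OF \<gamma> u s _ inside])
      then show ?thesis using M(1) K by simp
    next
      case False
      then have far: "1 \<le> 4 * norm (x - x0)" by (simp add: dist_norm norm_minus_commute)
      have "1 \<le> (4 * norm (x - x0)) powr \<beta>"
        using far \<beta> by (intro ge_one_powr_ge_zero) auto
      also have "\<dots> = 4 powr \<beta> * norm (x - x0) powr \<beta>" by (simp add: powr_mult)
      also have "\<dots> \<le> 64 * norm (x - x0) powr \<beta>"
        using powr_growth_le_cube[OF \<gamma>, of 4] by (intro mult_right_mono) (auto simp: \<beta>_def)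
      finally have "M * 1 \<le> M * (64 * norm (x - x0) powr \<beta>)" using M(1) by (intro mult_left_mono)
      also have "\<dots> = 64 * (M * norm (x - x0) powr \<beta>)" by simp
      also have "\<dots> \<le> (64 + 8 * K) * (M * norm (x - x0) powr \<beta>)"
        using M(1) K by (intro mult_right_mono) auto
      finally show ?thesis using M(2)[OF x] by simp
    qed
  next
    case False
    then have M0: "0 < M" using c by simp
    \<comment> \<open>As \<open>\<gamma> - 1\<close> is negative, the lower bound on
      \<open>M\<close> bounds the coefficient of the rescaled equation from above, independently of
      \<open>u\<close>.\<close>
    have "M powr (\<gamma> - 1) \<le> c powr (\<gamma> - 1)"
      using False c \<gamma> by (intro powr_mono2') auto
    moreover have "0 \<le> M powr (\<gamma> - 1)" by simp
    ultimately have L: "(1 / 2)\<^sup>2 * M powr (\<gamma> - 1) \<le> c powr (\<gamma> - 1)"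
      unfolding power2_eq_square by linarith
    have "\<bar>u x\<bar> \<le> M * K * (norm (x - x0) / (1 / 2)) powr \<beta>"
      unfolding K_def \<beta>_def
      by (rule branching_point_growth[OF \<gamma> _ u b _ s M0 M(2) L x]) (use c in auto)
    also have "(norm (x - x0) / (1 / 2)) powr \<beta> = 2 powr \<beta> * norm (x - x0) powr \<beta>"
      by (simp add: powr_mult mult.commute)
    also have "M * K * (2 powr \<beta> * norm (x - x0) powr \<beta>) \<le> M * K * (8 * norm (x - x0) powr \<beta>)"
      using powr_growth_le_cube[OF \<gamma>, of 2] M0 K
      by (intro mult_left_mono mult_right_mono) (auto simp: \<beta>_def)
    also have "\<dots> = (8 * K) * (M * norm (x - x0) powr \<beta>)" by simp
    also have "\<dots> \<le> (64 + 8 * K) * (M * norm (x - x0) powr \<beta>)"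
      using M0 by (intro mult_right_mono) auto
    finally show ?thesis .
  qed
  then show ?thesis by (simp add: K_def c_def \<beta>_def mult.assoc)
qed

text \<open>The constant may depend on \<open>u\<close> here, so \<open>\<Lambda>\<close> is taken
  to be the coefficient of the rescaled equation itself, and local boundedness by continuity
  replaces the global norm.\<close>

lemma branching_point_pointwise_growth:
  fixes u :: "real^'n \<Rightarrow> real"
  assumes \<gamma>: "0 < \<gamma>" "\<gamma> < 1 / 3"
    and u: "viscosity_solution \<Omega> (\<lambda>t. pos_part t powr \<gamma> - neg_part t powr \<gamma>) u"
    and b: "branching_point u x0" and \<Omega>: "open \<Omega>" "x0 \<in> \<Omega>"
  shows "pointwise_C_growth (2 / (1 - \<gamma>)) u x0"
proof -
  obtain s where s: "s > 0" "cball x0 s \<subseteq> \<Omega>" using \<Omega> open_contains_cball by blast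
  have sub: "ball x0 s \<subseteq> \<Omega>" using s ball_subset_cball by blast
  have "continuous_on (cball x0 s) u"
    using u s unfolding viscosity_solution_def by (meson continuous_on_subset)
  then have "bounded (u ` cball x0 s)" by (intro compact_imp_bounded compact_continuous_image) auto
  then obtain M where M: "M > 0" "\<And>x. x \<in> cball x0 s \<Longrightarrow> \<bar>u x\<bar> \<le> M"
    by (auto simp: bounded_pos)
  define \<Lambda> where "\<Lambda> = s\<^sup>2 * M powr (\<gamma> - 1)"
  define K where "K = bootstrap_const TYPE('n) \<Lambda> \<gamma> powr (1 / (1 - \<gamma>))"
  have "\<bar>u x\<bar> \<le> M * K * (1 / s) powr (2 / (1 - \<gamma>)) * norm (x - x0) powr (2 / (1 - \<gamma>))" if x: "x \<in> ball x0 s" for x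
  proof -
    have "\<bar>u x\<bar> \<le> M * K * (norm (x - x0) / s) powr (2 / (1 - \<gamma>))"
      unfolding K_def
      by (rule branching_point_growth[OF \<gamma> _ u b s(1) sub M(1) _ _ x])
         (use M s in \<open>auto simp: \<Lambda>_def\<close>)
    also have "norm (x - x0) / s = (1 / s) * norm (x - x0)" by simp
    finally show ?thesis by (simp only: powr_mult mult.assoc)
  qed
  then show ?thesis
    unfolding pointwise_C_growth_def eventually_nhds using s(1)
    by (intro exI[of _ "M * K * (1 / s) powr (2 / (1 - \<gamma>))"] exI[of _ "ball x0 s"]) auto
qed

theorem theorem5p1:
  fixes \<gamma> :: real
  assumes "0 < \<gamma>" and "\<gamma> < 1 / 3"
  shows "\<exists>C>0. \<forall>u :: real^'n \<Rightarrow> real.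
           viscosity_solution (ball 0 1) (\<lambda>t. pos_part t powr \<gamma> - neg_part t powr \<gamma>) u \<longrightarrow>
             (\<forall>x0 \<in> ball 0 (1 / 2). branching_point u x0 \<longrightarrow>
                (\<forall>x \<in> ball x0 (1 / 2).
                   ennreal \<bar>u x\<bar>
                     \<le> ennreal C * Linf_norm u * ennreal (norm (x - x0) powr (2 / (1 - \<gamma>))))) \<and>
             (\<forall>x0 \<in> ball 0 1. branching_point u x0 \<longrightarrow>
                pointwise_C_growth (2 / (1 - \<gamma>)) u x0)"
proof -
  define C where "C = 64 + 8 * bootstrap_const TYPE('n) (dead_core_level TYPE('n) powr (\<gamma> - 1)) \<gamma> powr (1 / (1 - \<gamma>))"
  have C: "C > 0" by (simp add: C_def add_pos_nonneg)
  have "ennreal \<bar>u x\<bar> \<le> ennreal C * Linf_norm u * ennreal (norm (x - x0) powr (2 / (1 - \<gamma>)))"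
    if u: "viscosity_solution (ball 0 1) (\<lambda>t. pos_part t powr \<gamma> - neg_part t powr \<gamma>) u"
      and x0: "x0 \<in> ball 0 (1 / 2)" and b: "branching_point u x0" and x: "x \<in> ball x0 (1 / 2)"
    for u :: "real^'n \<Rightarrow> real" and x0 x
  proof (cases "Linf_norm u")
    case (real M)
    have sub: "ball x0 (1 / 2) \<subseteq> ball 0 1"
      using x0 by (intro ball_subset_ball_iff[THEN iffD2]) (simp add: dist_norm)
    have cont: "continuous_on (ball 0 1) u" using u by (simp add: viscosity_solution_def)
    have bound: "\<bar>u y\<bar> \<le> M" if "y \<in> ball x0 (1 / 2)" for y
      using Linf_norm_bound_on_open[OF open_ball cont real] sub that by blast
    have "\<bar>u x\<bar> \<le> C * M * norm (x - x0) powr (2 / (1 - \<gamma>))"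
      unfolding C_def by (rule branching_point_growth_linear[OF assms u b sub real(1) bound x])
    then have "ennreal \<bar>u x\<bar> \<le> ennreal (C * M * norm (x - x0) powr (2 / (1 - \<gamma>)))" by (rule ennreal_leI)
    then show ?thesis using C real by (simp add: ennreal_mult)
  next
    case top
    \<comment> \<open>With infinite norm the right-hand side is infinite except at
      \<open>x = x0\<close>, where infinity times zero is zero and the estimate rests on
      \<open>u x0 = 0\<close>.\<close>
    have "u x0 = 0" using b by (simp add: branching_point_def)
    then show ?thesis using C top by (cases "x = x0") (auto simp: ennreal_mult_top ennreal_top_mult)
  qed
  moreover have "pointwise_C_growth (2 / (1 - \<gamma>)) u x0"
    if "viscosity_solution (ball 0 1) (\<lambda>t. pos_part t powr \<gamma> - neg_part t powr \<gamma>) u"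
      and "x0 \<in> ball 0 1" and "branching_point u x0" for u :: "real^'n \<Rightarrow> real" and x0
    using branching_point_pointwise_growth[OF assms that(1,3) open_ball that(2)] .
  ultimately show ?thesis using C by blast
qed

end
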